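(* Let $S=\{a_1,a_2,\dots,a_n\}$ be a finite set of non-zero integers, let $d\ge 3$ be an integer with $8\mid d$, let $\zeta_d$ denote a primitive $d$-th root of unity, and let $\mathbb{K}=\mathbb{Q}(\sqrt{a_1},\sqrt{a_2},\dots,\sqrt{a_n},\zeta_d)$. Then there exists an explicit isomorphism between $\mathbf{D}_0(S)$ and $\mathrm{Gal}(\mathbb{K}/\mathbb{Q})$.
   Context: For a non-zero integer $m$, $\mathrm{sqf}(m)$ is its squarefree part: the unique squarefree integer $s$ (of the same sign as $m$) with $m=sk^2$ for some integer $k$. For a finite set $T$ of non-zero integers, $\mathrm{sqf}(T)=\mathrm{sqf}\left(\prod_{s\in T}s\right)$, and $\mathrm{sqf}(\emptyset)=1$. Let $\mathcal{D}_0=\{T\subseteq S:\mathrm{sqf}(T)\mid d\}$. $\mathbf{F}(S)$ is the group, under pointwise multiplication, of all maps $\theta:S\to\{-1,1\}$; for $T\subseteq S$, $\theta(T)=\prod_{s\in T}\theta(s)$, with $\theta(\emptyset)=1$. $\mathbb{Z}_d^*=\{1\le f<d:(f,d)=1\}$ is the group of units modulo $d$. $\left(\frac{\cdot}{f}\right)$ is the Jacobi symbol. Define $$\mathbf{D}_0(S)=\left\{(f,\theta)\in\mathbb{Z}_d^*\times\mathbf{F}(S):\theta(T)\left(\frac{\mathrm{sqf}(T)}{f}\right)=1\ \text{for all } T\in\mathcal{D}_0\right\},$$ a subgroup of the direct product $\mathbb{Z}_d^*\times\mathbf{F}(S)$. *)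

theory Defs
  imports
    "HOL-Algebra.Algebraic_Closure_Type"
    "HOL-Algebra.Generated_Fields"
    "HOL-Algebra.Product_Groups"
    "HOL-Algebra.Bij"
    "HOL-Algebra.IntRing"
    "HOL-Number_Theory.Number_Theory"
    "HOL-Computational_Algebra.Squarefree"
begin

subsection \<open>Squarefree parts and the Jacobi symbol\<close>

definition sqf :: "int set \<Rightarrow> int" where
  "sqf T = squarefree_part (\<Prod>s\<in>T. s)"

text \<open>On integers, the library's \<^const>\<open>squarefree_part\<close> keeps the sign, and it is the only
  squarefree \<open>s\<close> such that \<open>m = s k\<^sup>2\<close> for some \<open>k\<close>.\<close>

lemma squarefree_part_int_unique:
  fixes m s k :: int
  assumes "m \<noteq> 0" "squarefree s" "m = s * k\<^sup>2"
  shows "s = squarefree_part m"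
proof -
  define t l where "t = squarefree_part m" and "l = square_part m"
  have m: "m = t * l\<^sup>2" and t: "squarefree t"
    by (simp_all add: t_def l_def flip: squarefree_decompose)
  from m assms have nz: "s \<noteq> 0" "t \<noteq> 0" "k \<noteq> 0" "l \<noteq> 0" by auto
  have mult: "multiplicity p x = multiplicity p m mod 2"
    if p: "prime p" and x: "squarefree x" "m = x * y\<^sup>2" "x \<noteq> 0" "y \<noteq> 0" for p x y :: int
  proof -
    have "multiplicity p m = multiplicity p x + 2 * multiplicity p y"
      using prime_imp_prime_elem[OF p] x(3,4) unfolding x(2)
      by (simp add: prime_elem_multiplicity_mult_distrib prime_elem_multiplicity_power_distrib)
    moreover have "multiplicity p x \<le> 1"
      using x p squarefree_factorial_semiring''[of x] by auto
    ultimately show ?thesis by auto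
  qed
  have "normalize s = normalize t"
    using nz mult[of _ s k] mult[of _ t l] assms m t
    by (intro multiplicity_eq_imp_eq) auto
  hence abs: "\<bar>s\<bar> = \<bar>t\<bar>" by simp
  have "sgn (k\<^sup>2) = 1" "sgn (l\<^sup>2) = 1"
    using nz by (simp_all only: sgn_1_pos zero_less_power2 not_False_eq_True)
  hence "sgn s = sgn m" "sgn t = sgn m"
    using arg_cong[OF assms(3), of sgn] arg_cong[OF m, of sgn] by (simp_all only: sgn_mult mult_1_right)
  with abs have "s = t" by (metis mult_sgn_abs)
  thus ?thesis by (simp add: t_def)
qed

text \<open>The usual Jacobi symbol for odd \<open>f > 0\<close>; for other \<open>f\<close> the value has no meaning.\<close>

definition Jacobi :: "int \<Rightarrow> int \<Rightarrow> int" where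
  "Jacobi a f = (\<Prod>p\<in>#prime_factorization f. Legendre a p)"

subsection \<open>The group of compatible pairs of units and sign maps\<close>

definition unit_group_mod :: "nat \<Rightarrow> int monoid" where
  "unit_group_mod d = units_of (residue_ring (int d))"

lemma carrier_unit_group_mod:
  assumes "d \<ge> 2"
  shows "carrier (unit_group_mod d) = {f. 1 \<le> f \<and> f < int d \<and> coprime f (int d)}"
proof -
  interpret residues "int d" "residue_ring (int d)"
    using assms by unfold_locales auto
  show ?thesis
    by (auto simp: unit_group_mod_def units_of_carrier res_units_eq)
qed

definition sign_maps :: "int set \<Rightarrow> (int \<Rightarrow> int) monoid" where
  "sign_maps S = product_group S (\<lambda>_. units_of \<Z>)"

lemma carrier_sign_maps: "carrier (sign_maps S) = S \<rightarrow>\<^sub>E {-1, 1}"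
proof -
  have "Units \<Z> = {-1, 1 :: int}"
    by (auto simp: Units_def zmult_eq_1_iff)
  thus ?thesis by (simp add: sign_maps_def units_of_carrier)
qed

definition D0_family :: "int set \<Rightarrow> nat \<Rightarrow> int set set" where
  "D0_family S d = {T. T \<subseteq> S \<and> sqf T dvd int d}"

definition D0_group :: "int set \<Rightarrow> nat \<Rightarrow> (int \<times> (int \<Rightarrow> int)) monoid" where
  "D0_group S d = (unit_group_mod d \<times>\<times> sign_maps S)
     \<lparr>carrier := {(f, \<theta>). f \<in> carrier (unit_group_mod d) \<and> \<theta> \<in> carrier (sign_maps S) \<and>
        (\<forall>T\<in>D0_family S d. (\<Prod>s\<in>T. \<theta> s) * Jacobi (sqf T) f = 1)}\<rparr>"

subsection \<open>Galois groups and the field \<open>\<rat>(\<surd>a\<^sub>1, \<dots>, \<surd>a\<^sub>n, \<zeta>)\<close>\<close>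

text \<open>The group of automorphisms of \<open>L\<close> that fix \<open>K\<close> pointwise. As in the library's
  \<^const>\<open>BijGroup\<close>, automorphisms are extensional on the carrier of \<open>L\<close>.\<close>

definition galois_group :: "('a, 'b) ring_scheme \<Rightarrow> 'a set \<Rightarrow> ('a \<Rightarrow> 'a) monoid" where
  "galois_group L K = BijGroup (carrier L)
     \<lparr>carrier := {\<sigma> \<in> Bij (carrier L). \<sigma> \<in> ring_iso L L \<and> (\<forall>x\<in>K. \<sigma> x = x)}\<rparr>"

definition sqrt_cyclotomic_field :: "int set \<Rightarrow> complex \<Rightarrow> complex ring" where
  "sqrt_cyclotomic_field S \<zeta> = ring_of_type_algebra
     \<lparr>carrier := generate_field ring_of_type_algebra
        (\<rat> \<union> (\<lambda>a. csqrt (of_int a)) ` S \<union> {\<zeta>})\<rparr>"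

definition primitive_root_of_unity :: "nat \<Rightarrow> complex \<Rightarrow> bool" where
  "primitive_root_of_unity d \<zeta> \<longleftrightarrow> \<zeta> ^ d = 1 \<and> (\<forall>k. 0 < k \<and> k < d \<longrightarrow> \<zeta> ^ k \<noteq> 1)"

end

theory Submission
  imports Defs
begin

text \<open>
  Let \<open>N = d \<bar>a\<^sub>1 \<cdots> a\<^sub>n\<bar>\<close>. The field \<open>K = \<rat>(\<surd>a\<^sub>1, \<dots>, \<surd>a\<^sub>n, \<zeta>)\<close> lies in \<open>\<rat>(w)\<close> for a primitive \<open>N\<close>-th
  root of unity \<open>w\<close>, because \<open>8\<close> divides \<open>N\<close> and \<open>\<Prod>(1 - v\<^sup>k) = p\<close> for a primitive \<open>p\<close>-th root of
  unity \<open>v\<close>. By the irreducibility of cyclotomic polynomials every \<open>g\<close> coprime to \<open>N\<close> gives an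
  automorphism \<open>w \<mapsto> w\<^sup>g\<close> of \<open>\<rat>(w)\<close>, and a Frobenius argument shows that it multiplies \<open>\<surd>m\<close> by the
  Jacobi symbol of \<open>m\<close> over \<open>g\<close> whenever all primes dividing \<open>m\<close> divide \<open>N\<close>.

  An automorphism \<open>\<sigma>\<close> of \<open>K\<close> determines \<open>f\<close> and \<open>\<theta>\<close> by \<open>\<sigma> \<zeta> = \<zeta>\<^sup>f\<close> and \<open>\<sigma> \<surd>a = \<theta>(a) \<surd>a\<close>, and is determined
  by them. If \<open>m = sqf(T)\<close> divides \<open>d\<close>, then \<open>\<surd>m \<in> \<rat>(\<zeta>)\<close>, so \<open>\<theta>(T)\<close> is the Jacobi symbol of \<open>m\<close> over
  \<open>f\<close>. Conversely, given a pair satisfying these conditions, it suffices to find \<open>g \<equiv> f\<close> modulo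
  \<open>d\<close>, coprime to \<open>N\<close>, such that the Jacobi symbol of each \<open>a \<in> S\<close> over \<open>g\<close> is \<open>\<theta>(a)\<close>, and to restrict
  \<open>w \<mapsto> w\<^sup>g\<close> to \<open>K\<close>. By quadratic reciprocity and the Chinese remainder theorem the symbols over \<open>g\<close>
  of the primes not dividing \<open>d\<close> can be prescribed freely; what remains is a linear system over
  the field with two elements, whose solvability conditions are exactly those for the sets
  \<open>T\<close> with \<open>sqf(T)\<close> dividing \<open>d\<close>.
\<close>

subsection \<open>Integral polynomials at roots of unity\<close>

text \<open>The values at \<open>w\<close> form the ring \<open>\<int>[w]\<close>. Its elements are
  handled through polynomials because conjugation is then the substitution of \<open>w ^ g\<close>
  for \<open>w\<close>.\<close>

definition ev :: "int poly \<Rightarrow> complex \<Rightarrow> complex" where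
  "ev P x = poly (map_poly of_int P) x"

lemma ev_pCons [simp]: "ev (pCons a P) x = of_int a + x * ev P x"
  by (cases "pCons a P = 0") (auto simp: ev_def map_poly_pCons)

lemma ev_0 [simp]: "ev 0 x = 0"
  by (simp add: ev_def)

lemma ev_1 [simp]: "ev 1 x = 1"
  by (simp add: one_pCons)

lemma ev_add [simp]: "ev (P + Q) x = ev P x + ev Q x"
  by (induction P Q rule: poly_induct2) (auto simp: algebra_simps)

lemma ev_smult [simp]: "ev (smult c P) x = of_int c * ev P x"
  by (induction P) (auto simp: algebra_simps)

lemma ev_mult [simp]: "ev (P * Q) x = ev P x * ev Q x"
  by (induction P) (auto simp: algebra_simps)

lemma ev_uminus [simp]: "ev (- P) x = - ev P x"
  using ev_smult[of "-1" P x] by simp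

lemma ev_diff [simp]: "ev (P - Q) x = ev P x - ev Q x"
  using ev_add[of P "- Q" x] by simp

lemma ev_power [simp]: "ev (P ^ n) x = ev P x ^ n"
  by (induction n) auto

lemma ev_monom [simp]: "ev (monom c n) x = of_int c * x ^ n"
  by (induction n) (auto simp: monom_altdef)

lemma ev_pcompose [simp]: "ev (P \<circ>\<^sub>p Q) x = ev P (ev Q x)"
  by (induction P) (auto simp: pcompose_pCons)

lemma ev_prod [simp]: "ev (prod F A) x = (\<Prod>i\<in>A. ev (F i) x)"
  by (induction A rule: infinite_finite_induct) auto

section \<open>Frobenius congruences modulo a prime\<close>

lemma prime_binomial_cong:
  fixes a b :: "'a :: comm_ring_1"
  assumes "prime q"
  shows "\<exists>c. (a + b) ^ q = a ^ q + b ^ q + of_nat q * c"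
proof -
  have q: "q > 0" using assms by (simp add: prime_gt_0_nat)
  have "\<exists>c. of_nat (q choose k) * a ^ k * b ^ (q - k) = of_nat q * c" if "k \<in> {1..<q}" for k
  proof -
    have "q dvd (q choose k)" using that assms by (intro dvd_choose_prime) auto
    then obtain m where "q choose k = q * m" by (elim dvdE)
    thus ?thesis by (intro exI[of _ "of_nat m * a ^ k * b ^ (q - k)"]) (simp add: mult.assoc)
  qed
  then obtain c where c: "\<And>k. k \<in> {1..<q} \<Longrightarrow> of_nat (q choose k) * a ^ k * b ^ (q - k) = of_nat q * c k"
    by metis
  have "{..q} = insert 0 (insert q {1..<q})" using q by auto
  hence "(a + b) ^ q = b ^ q + (a ^ q + (\<Sum>k\<in>{1..<q}. of_nat (q choose k) * a ^ k * b ^ (q - k)))"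
    using q by (simp add: binomial_ring)
  also have "(\<Sum>k\<in>{1..<q}. of_nat (q choose k) * a ^ k * b ^ (q - k)) = of_nat q * (\<Sum>k\<in>{1..<q}. c k)"
    unfolding sum_distrib_left by (intro sum.cong refl c)
  finally have "(a + b) ^ q = a ^ q + b ^ q + of_nat q * (\<Sum>k\<in>{1..<q}. c k)"
    by (simp only: ac_simps)
  thus ?thesis by blast
qed

lemma fermat_int:
  assumes "prime q"
  shows "\<exists>c::int. a ^ q = a + of_nat q * c"
proof -
  define b where "b = nat (a mod int q)"
  have q: "q > 0" by (rule prime_gt_0_nat) fact
  have "[b ^ q = b] (mod q)"
  proof (cases "q dvd b")
    case True
    moreover have "q dvd b ^ q" using True q by (metis dvd_power dvd_trans)
    ultimately show ?thesis by (metis cong_0_iff cong_sym cong_trans)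
  next
    case False
    hence "[b * b ^ (q - 1) = b * 1] (mod q)"
      using fermat_theorem[OF assms] by (intro cong_mult cong_refl)
    thus ?thesis using q by (simp add: power_eq_if)
  qed
  hence "[int b ^ q = int b] (mod int q)" by (metis cong_int_iff of_nat_power)
  moreover have "[int b = a] (mod int q)" using q by (simp add: b_def cong_def)
  ultimately have "[a ^ q = a] (mod int q)" by (meson cong_pow cong_sym cong_trans)
  hence "int q dvd a ^ q - a" by (simp add: cong_iff_dvd_diff)
  then obtain c where "a ^ q - a = int q * c" by (elim dvdE)
  thus ?thesis by (intro exI[of _ c]) simp
qed

text \<open>Modulo the prime \<open>q\<close>, raising to the power \<open>q\<close> is additive and
  fixes integer constants, so only the variable changes, to its \<open>q\<close>-th power.\<close>

lemma frobenius_int_poly: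
  fixes P :: "int poly"
  assumes "prime q"
  shows "\<exists>Q. P ^ q = P \<circ>\<^sub>p monom 1 q + smult (int q) Q"
proof (induction P)
  case 0
  show ?case using assms by (intro exI[of _ 0]) (simp add: prime_gt_0_nat)
next
  case (pCons a P)
  then obtain Q where Q: "P ^ q = P \<circ>\<^sub>p monom 1 q + smult (int q) Q" by blast
  obtain R where R: "([:a:] + [:0, 1:] * P) ^ q = [:a:] ^ q + ([:0, 1:] * P) ^ q + of_nat q * R"
    using prime_binomial_cong[OF assms] by blast
  obtain c where c: "a ^ q = a + of_nat q * c" using fermat_int[OF assms] by blast
  have "pCons a P = [:a:] + [:0, 1:] * P" by simp
  hence "pCons a P ^ q = [:a:] ^ q + [:0, 1:] ^ q * P ^ q + of_nat q * R"
    by (simp only: R power_mult_distrib)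
  also have "\<dots> = [:a ^ q:] + monom 1 q * P ^ q + smult (int q) R"
    by (simp add: of_nat_poly monom_altdef poly_const_pow)
  also have "\<dots> = pCons a P \<circ>\<^sub>p monom 1 q + smult (int q) ([:c:] + monom 1 q * Q + R)"
    by (simp add: c Q pcompose_pCons algebra_simps smult_add_right)
  finally show ?case by blast
qed

text \<open>The nonzero vector \<open>\<alpha>\<close> is by itself linearly independent over
  \<open>\<rat>\<close>, so the value 1 there extends to a linear map. Such maps turn divisibility
  in \<open>\<int>[w]\<close> into divisibility of rational integers.\<close>

lemma rat_linear_functional:
  fixes \<alpha> :: complex
  assumes "\<alpha> \<noteq> 0"
  obtains \<phi> :: "complex \<Rightarrow> rat" where "\<And>x y. \<phi> (x + y) = \<phi> x + \<phi> y"
    "\<And>r x. \<phi> (of_rat r * x) = r * \<phi> x" "\<phi> \<alpha> = 1"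
proof -
  interpret VP: vector_space_pair "\<lambda>(r::rat) (x::complex). of_rat r * x" "\<lambda>(r::rat) (x::rat). r * x"
    by unfold_locales (auto simp: algebra_simps of_rat_add of_rat_mult)
  have "VP.vs1.independent {\<alpha>}"
    using assms by (simp add: VP.vs1.dependent_single)
  from VP.linear_independent_extend[OF this, of "\<lambda>_. 1"] obtain g
    where g: "Vector_Spaces.linear (\<lambda>(r::rat) (x::complex). of_rat r * x) (\<lambda>(r::rat) (x::rat). r * x) g" "g \<alpha> = 1"
    by auto
  interpret g: Vector_Spaces.linear "\<lambda>(r::rat) (x::complex). of_rat r * x" "\<lambda>(r::rat) (x::rat). r * x" g
    by (fact g)
  show ?thesis using that[of g] g(2) g.add g.scale by blast
qed

lemma rat_common_denominator:
  assumes "finite A"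
  shows "\<exists>D::int. D > 0 \<and> (\<forall>r\<in>A. (of_int D * r :: rat) \<in> \<int>)"
  using assms
proof (induction A)
  case (insert x A)
  then obtain D where D: "D > 0" "\<forall>r\<in>A. (of_int D * r :: rat) \<in> \<int>" by blast
  obtain a b where x: "x = Rat.Fract a b" "b > 0" by (metis Rat_cases)
  have "of_int (D * b) * x = of_int (D * a)" using x by (simp add: Fract_of_int_quotient)
  hence "of_int (D * b) * x \<in> \<int>" by (metis Ints_of_int)
  moreover have "of_int (D * b) * r \<in> \<int>" if "r \<in> A" for r
  proof -
    have "of_int (D * b) * r = of_int b * (of_int D * r)" by simp
    thus ?thesis using D that by (metis Ints_mult Ints_of_int)
  qed
  ultimately show ?case using D x by (intro exI[of _ "D * b"]) auto
qed (auto intro: exI[of _ 1])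

text \<open>This covers every \<open>N\<close>-th root of unity, in particular the powers
  \<open>w ^ g\<close>, at which \<open>ev_pow_nonzero\<close> instantiates the locale.\<close>

locale root_of_unity =
  fixes w :: complex and N :: nat
  assumes N_pos: "N > 0" and root: "w ^ N = 1"
begin

lemma power_cong: "[i = j] (mod N) \<Longrightarrow> w ^ i = w ^ j"
proof -
  have *: "w ^ i = w ^ (i mod N)" for i
  proof -
    have "w ^ i = w ^ (N * (i div N) + i mod N)" by simp
    also have "\<dots> = w ^ (i mod N)" unfolding power_add power_mult root by simp
    finally show ?thesis .
  qed
  show "[i = j] (mod N) \<Longrightarrow> w ^ i = w ^ j" using *[of i] *[of j] by (simp add: cong_def)
qed

text \<open>Evaluating a \<open>\<rat>\<close>-linear functional on \<open>\<int>[w]\<close> replaces the norm: its values there have a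
  common denominator.\<close>

lemma functional_bounded_denominator:
  fixes \<phi> :: "complex \<Rightarrow> rat"
  assumes add: "\<And>x y. \<phi> (x + y) = \<phi> x + \<phi> y"
    and scale: "\<And>r x. \<phi> (of_rat r * x) = r * \<phi> x"
  obtains D :: int where "D > 0" "\<And>P. of_int D * \<phi> (ev P w) \<in> \<int>"
proof -
  obtain D :: int where D: "D > 0" "\<forall>r\<in>(\<lambda>i. \<phi> (w ^ i)) ` {..<N}. of_int D * r \<in> \<int>"
    using rat_common_denominator[of "(\<lambda>i. \<phi> (w ^ i)) ` {..<N}"] by auto
  have *: "of_int D * \<phi> (w ^ j) \<in> \<int>" for j
  proof -
    have "w ^ j = w ^ (j mod N)" by (intro power_cong) (simp add: cong_def)
    thus ?thesis using D N_pos by simp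
  qed
  \<comment> \<open>The factor \<open>w ^ j\<close> is carried along because each coefficient peeled
    off \<open>P\<close> raises the exponent by one.\<close>
  have "of_int D * \<phi> (w ^ j * ev P w) \<in> \<int>" for P j
  proof (induction P arbitrary: j)
    case 0
    show ?case using scale[of 0 0] by simp
  next
    case (pCons a P)
    have "w ^ j * ev (pCons a P) w = of_rat (of_int a) * w ^ j + w ^ Suc j * ev P w"
      by (simp add: algebra_simps)
    hence "of_int D * \<phi> (w ^ j * ev (pCons a P) w)
        = of_int a * (of_int D * \<phi> (w ^ j)) + of_int D * \<phi> (w ^ Suc j * ev P w)"
      unfolding add scale by (simp only: add scale distrib_left mult.left_commute)
    thus ?case using * pCons.IH by (metis Ints_add Ints_mult Ints_of_int)
  qed
  from this[of 0] show ?thesis using that D(1) by simp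
qed

text \<open>Take \<open>\<phi>\<close> with value 1 at \<open>ev P w\<close>. Then
  \<open>1 = q * \<phi> (ev Q w)\<close>, and multiplying by the common denominator \<open>D\<close>
  shows that \<open>q\<close> divides \<open>D\<close>.\<close>

lemma bounded_divisors:
  assumes "ev P w \<noteq> 0"
  obtains B :: nat where "\<And>q Q. q > 0 \<Longrightarrow> ev P w = of_nat q * ev Q w \<Longrightarrow> q \<le> B"
proof -
  obtain \<phi> :: "complex \<Rightarrow> rat" where \<phi>: "\<And>x y. \<phi> (x + y) = \<phi> x + \<phi> y"
    "\<And>r x. \<phi> (of_rat r * x) = r * \<phi> x" "\<phi> (ev P w) = 1"
    using rat_linear_functional[OF assms] by blast
  obtain D :: int where D: "D > 0" "\<And>P. of_int D * \<phi> (ev P w) \<in> \<int>"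
    using functional_bounded_denominator[OF \<phi>(1,2)] by blast
  have "q \<le> nat D" if q: "q > 0" "ev P w = of_nat q * ev Q w" for q Q
  proof -
    have "1 = \<phi> (of_rat (of_nat q) * ev Q w)" using \<phi>(3) q by simp
    hence "1 = of_nat q * \<phi> (ev Q w)" by (simp only: \<phi>(2))
    moreover obtain k where "of_int D * \<phi> (ev Q w) = of_int k" using D(2)[of Q] by (elim Ints_cases)
    ultimately have "(of_int D :: rat) = of_int (int q * k)"
      by (metis (no_types, opaque_lifting) mult.commute mult.left_commute mult.right_neutral of_int_mult of_int_of_nat_eq)
    hence "D = int q * k" by (simp only: of_int_eq_iff)
    hence "int q \<le> D" using D(1) by (intro zdvd_imp_le) auto
    thus ?thesis by simp
  qed
  thus ?thesis using that by blast
qed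

text \<open>If \<open>p\<close> did not divide \<open>u\<close>, the \<open>k\<close>-th power of
  the equation, under a functional with \<open>\<phi> 1 = 1\<close>, would make \<open>p ^ k\<close>
  divide \<open>D * u ^ k\<close> and hence \<open>D\<close>, for every \<open>k\<close>. This
  replaces the fact that a rational algebraic integer is an integer.\<close>

lemma prime_dvd_of_int_eq:
  assumes "prime p" "of_int u = of_nat p * ev Q w"
  shows "int p dvd u"
proof (rule ccontr)
  assume ndvd: "\<not> int p dvd u"
  obtain \<phi> :: "complex \<Rightarrow> rat" where \<phi>: "\<And>x y. \<phi> (x + y) = \<phi> x + \<phi> y"
    "\<And>r x. \<phi> (of_rat r * x) = r * \<phi> x" "\<phi> 1 = 1"
    using rat_linear_functional[OF one_neq_zero] by blast
  obtain D :: int where D: "D > 0" "\<And>P. of_int D * \<phi> (ev P w) \<in> \<int>"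
    using functional_bounded_denominator[OF \<phi>(1,2)] by blast
  have p: "p > 1" by (rule prime_gt_1_nat) fact
  have dvd: "int p ^ k dvd D" for k
  proof -
    have "(of_int u :: complex) ^ k = of_nat p ^ k * ev (Q ^ k) w" unfolding assms(2) power_mult_distrib by simp
    hence "of_rat (of_int (u ^ k)) * (1::complex) = of_rat (of_int (int p ^ k)) * ev (Q ^ k) w"
      by (simp add: of_rat_power)
    hence "\<phi> (of_rat (of_int (u ^ k)) * 1) = \<phi> (of_rat (of_int (int p ^ k)) * ev (Q ^ k) w)"
      by simp
    hence "of_int (u ^ k) = of_int (int p ^ k) * \<phi> (ev (Q ^ k) w)"
      unfolding \<phi>(2,3) by simp
    moreover obtain l where "of_int D * \<phi> (ev (Q ^ k) w) = of_int l" using D(2) Ints_cases by metis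
    ultimately have "of_int (D * u ^ k) = (of_int (int p ^ k * l) :: rat)"
      by (simp add: mult.left_commute)
    hence "D * u ^ k = int p ^ k * l" by (simp only: of_int_eq_iff)
    moreover have "coprime (int p ^ k) (u ^ k)"
      using ndvd assms(1) by (simp add: prime_imp_coprime)
    ultimately show ?thesis by (metis coprime_dvd_mult_left_iff dvd_triv_left)
  qed
  have "int p ^ nat D \<le> D" using dvd D(1) by (intro zdvd_imp_le) auto
  moreover have "nat D < p ^ nat D" using p by (intro power_gt_expt) auto
  ultimately show False using D(1) by (metis of_nat_power nat_less_iff not_less order_less_imp_le)
qed

end

section \<open>Polynomial relations and square roots under \<open>w \<mapsto> w ^ g\<close>\<close>

context root_of_unity
begin

lemma frobenius_at_power:
  assumes "prime q"
  shows "\<exists>Q. ev P (w ^ j) ^ q = ev P (w ^ (j * q)) + of_nat q * ev Q w"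
proof -
  obtain Q where Q: "P ^ q = P \<circ>\<^sub>p monom 1 q + smult (int q) Q"
    using frobenius_int_poly[OF assms] by blast
  have "ev P (w ^ j) ^ q = ev (P ^ q) (w ^ j)" by simp
  also have "\<dots> = ev P (w ^ (j * q)) + of_nat q * ev (Q \<circ>\<^sub>p monom 1 j) w"
    unfolding Q by (simp add: power_mult)
  finally show ?thesis by blast
qed

text \<open>A zero at \<open>w ^ j\<close> makes the value at \<open>w ^ (j * q)\<close> a multiple
  of \<open>q\<close> in \<open>\<int>[w]\<close>, by the Frobenius congruence. For large
  \<open>q\<close> this leaves only the value 0, by \<open>bounded_divisors\<close>. One bound
  serves all \<open>j\<close> since \<open>w\<close> has at most \<open>N\<close> different
  powers.\<close>

lemma root_pow_large_prime:
  obtains B :: nat where "\<And>q j. prime q \<Longrightarrow> q > B \<Longrightarrow> ev P (w ^ j) = 0 \<Longrightarrow> ev P (w ^ (j * q)) = 0"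
proof -
  have "\<exists>B. ev P (w ^ i) \<noteq> 0 \<longrightarrow> (\<forall>q Q. q > 0 \<longrightarrow> ev P (w ^ i) = of_nat q * ev Q w \<longrightarrow> q \<le> B)" for i
    using bounded_divisors[of "P \<circ>\<^sub>p monom 1 i"] by (auto, metis)
  then obtain B :: "nat \<Rightarrow> nat"
    where B: "\<And>i q Q. ev P (w ^ i) \<noteq> 0 \<Longrightarrow> q > 0 \<Longrightarrow> ev P (w ^ i) = of_nat q * ev Q w \<Longrightarrow> q \<le> B i"
    by metis
  have "ev P (w ^ (j * q)) = 0" if q: "prime q" "q > (\<Sum>i<N. B i)" "ev P (w ^ j) = 0" for q j
  proof (rule ccontr)
    assume nz: "ev P (w ^ (j * q)) \<noteq> 0"
    define i where "i = (j * q) mod N"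
    have i: "i < N" "w ^ (j * q) = w ^ i"
      using N_pos power_cong[of "j * q" i] by (auto simp: i_def cong_def)
    have q0: "q > 0" by (rule prime_gt_0_nat) fact
    obtain Q where "ev P (w ^ j) ^ q = ev P (w ^ (j * q)) + of_nat q * ev Q w"
      using frobenius_at_power[OF q(1)] by blast
    hence "ev P (w ^ i) = of_nat q * ev (- Q) w"
      using q(3) q0 i by (simp add: power_0_left eq_neg_iff_add_eq_0)
    hence "q \<le> B i" using nz i q0 B by metis
    also have "B i \<le> (\<Sum>i<N. B i)" using i by (intro member_le_sum) auto
    finally show False using q(2) by simp
  qed
  thus ?thesis using that by blast
qed

text \<open>Landau's proof that cyclotomic polynomials are irreducible: \<open>g\<close> is congruent modulo \<open>N\<close> to
  a number all of whose prime factors are large.\<close>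

lemma root_pow_coprime:
  assumes "ev P w = 0" "coprime g N"
  shows "ev P (w ^ g) = 0"
proof -
  obtain B where B: "\<And>q j. prime q \<Longrightarrow> q > B \<Longrightarrow> ev P (w ^ j) = 0 \<Longrightarrow> ev P (w ^ (j * q)) = 0"
    using root_pow_large_prime by blast
  \<comment> \<open>A prime up to \<open>B\<close> divides exactly one of \<open>g\<close> and
    \<open>N * \<Prod>A\<close>: if it divides \<open>g\<close>, it is prime to \<open>N\<close> and
    absent from \<open>A\<close>; otherwise it lies in \<open>A\<close>. Hence it does not divide
    \<open>g'\<close>.\<close>
  define A where "A = {p. prime p \<and> p \<le> B \<and> \<not> p dvd g}"
  define g' where "g' = g + N * \<Prod>A"
  have A: "finite A" unfolding A_def by (rule finite_subset[of _ "{..B}"]) auto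
  have large: "p > B" if p: "prime p" "p dvd g'" for p
  proof (rule ccontr)
    assume "\<not> p > B"
    show False
    proof (cases "p dvd g")
      case True
      hence "p dvd N * \<Prod>A" using p by (simp add: g'_def dvd_add_right_iff)
      moreover have "\<not> p dvd N" using True assms(2) p(1) by (metis coprime_common_divisor not_prime_unit)
      ultimately have "p dvd \<Prod>A" using p by (simp add: prime_dvd_mult_iff)
      then obtain q where "q \<in> A" "p dvd q" using p A by (auto simp: prime_dvd_prod_iff)
      thus False using True p by (metis A_def mem_Collect_eq primes_dvd_imp_eq)
    next
      case False
      hence "p \<in> A" using p \<open>\<not> p > B\<close> by (simp add: A_def)
      hence "p dvd N * \<Prod>A" using A by (meson dvd_mult dvd_prodI)
      hence "p dvd g" using p by (simp add: g'_def dvd_add_left_iff)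
      thus False using False by simp
    qed
  qed
  have "\<Prod>A \<noteq> 0" using A by (auto simp: A_def)
  hence "g' \<noteq> 0" using N_pos by (simp add: g'_def)
  moreover have "n \<noteq> 0 \<Longrightarrow> (\<And>p. prime p \<Longrightarrow> p dvd n \<Longrightarrow> p > B) \<Longrightarrow> ev P (w ^ n) = 0" for n
  proof (induction n rule: prime_divisors_induct)
    case (factor p x)
    have "ev P (w ^ x) = 0" using factor by (metis dvd_mult mult_zero_right)
    thus ?case using B[of p x] factor by (simp add: mult.commute)
  qed (use assms in auto)
  ultimately have "ev P (w ^ g') = 0" using large by blast
  moreover have "[g' = g] (mod N)" by (simp add: g'_def cong_def)
  ultimately show ?thesis using power_cong by metis
qed

lemma sqrt_pow_coprime:
  assumes "ev P w ^ 2 = of_int m" "coprime g N"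
  shows "ev P (w ^ g) ^ 2 = of_int m"
  using root_pow_coprime[of "P ^ 2 - [:m:]" g] assms by simp

text \<open>Modulo \<open>q\<close>, the value at \<open>w ^ q\<close> is the \<open>q\<close>-th
  power of \<open>ev P w\<close>, that is \<open>m ^ ((q - 1) div 2) * ev P w\<close>, and Euler's
  criterion brings in the Legendre symbol. Both sides are square roots of \<open>m\<close>, so a
  wrong sign would make \<open>q\<close> divide twice such a root.\<close>

lemma sqrt_pow_prime:
  assumes P: "ev P w ^ 2 = of_int m" and q: "prime q" "coprime q N" "\<not> int q dvd 2 * m"
  shows "ev P (w ^ q) = of_int (Legendre m q) * ev P w"
proof -
  have "q \<noteq> 2" using q(3) by auto
  hence q2: "q > 2" using prime_ge_2_nat[OF q(1)] by simp
  have odd: "odd q" using q q2 by (intro prime_odd_nat) auto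
  define L where "L = Legendre m (int q)"
  have L: "L = 1 \<or> L = -1"
    using q(3) by (auto simp: L_def Legendre_def cong_0_iff)
  have "[L = m ^ ((q - 1) div 2)] (mod int q)"
    unfolding L_def using euler_criterion[of q m] q q2 by simp
  then obtain c where c: "m ^ ((q - 1) div 2) = L + int q * c"
    by (metis cong_iff_lin)
  obtain Q where Q: "ev P w ^ q = ev P (w ^ q) + of_nat q * ev Q w"
    using frobenius_at_power[OF q(1), of P 1] by auto
  have "ev P w ^ q = (ev P w ^ 2) ^ ((q - 1) div 2) * ev P w"
    using odd by (metis odd_two_times_div_two_succ add_diff_cancel_right' oddE power_add power_mult
        nonzero_mult_div_cancel_left power_one_right zero_neq_numeral)
  also have "\<dots> = of_int (m ^ ((q - 1) div 2)) * ev P w" by (simp add: P)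
  finally have eq: "of_int L * ev P w - ev P (w ^ q) = of_nat q * ev (Q - smult c P) w"
    unfolding c Q by (simp add: algebra_simps)
  have sgn: "ev P (w ^ q) = ev P w \<or> ev P (w ^ q) = - ev P w"
    using sqrt_pow_coprime[OF P q(2)] P by (metis power2_eq_iff)
  show ?thesis
  proof (rule ccontr)
    assume "ev P (w ^ q) \<noteq> of_int (Legendre m q) * ev P w"
    hence "2 * (of_int L * ev P w) = of_nat q * ev (Q - smult c P) w"
      using sgn L eq by (auto simp: L_def[symmetric])
    \<comment> \<open>Squaring leads from \<open>\<int>[w]\<close> to the rational integer
      \<open>4 * m\<close>, to which \<open>prime_dvd_of_int_eq\<close> applies.\<close>
    hence "(2 * (of_int L * ev P w)) ^ 2 = of_nat q * ev (smult (int q) ((Q - smult c P) ^ 2)) w"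
      by (simp add: power2_eq_square)
    moreover have "(2 * (of_int L * ev P w)) ^ 2 = 4 * of_int m" using L P by auto
    ultimately have "of_int (4 * m) = of_nat q * ev (smult (int q) ((Q - smult c P) ^ 2)) w" by simp
    hence "int q dvd 4 * m" by (rule prime_dvd_of_int_eq[OF q(1)])
    hence "int q dvd 2 * (2 * m)" by simp
    moreover have "prime (int q)" using q by simp
    ultimately have "int q dvd 2 \<or> int q dvd 2 * m" using prime_dvd_multD by blast
    thus False using q(3) by auto
  qed
qed

end

lemma Jacobi_1 [simp]: "Jacobi a 1 = 1"
  by (simp add: Jacobi_def)

lemma Jacobi_prime_mult:
  assumes "prime q" "x \<noteq> 0"
  shows "Jacobi a (int (q * x)) = Legendre a (int q) * Jacobi a (int x)"
  using assms by (simp add: Jacobi_def prime_factorization_mult prime_factorization_prime)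

context root_of_unity
begin

text \<open>Prime factors \<open>q\<close> of \<open>g\<close> are split off one at a time:
  \<open>P\<close> composed with \<open>monom 1 x\<close> again gives a square root of
  \<open>m\<close> at \<open>w\<close>, so \<open>sqrt_pow_prime\<close> applies to it.\<close>

lemma sqrt_pow_Jacobi:
  assumes P: "ev P w ^ 2 = of_int m" and g: "g \<noteq> 0" "coprime g N" "coprime (int g) (2 * m)"
  shows "ev P (w ^ g) = of_int (Jacobi m (int g)) * ev P w"
  using g
proof (induction g rule: prime_divisors_induct)
  case (factor q x)
  have x: "x \<noteq> 0" "coprime x N" "coprime (int x) (2 * m)"
    and q: "prime q" "coprime q N" "coprime (int q) (2 * m)"
    using factor by auto
  have "ev (P \<circ>\<^sub>p monom 1 x) w ^ 2 = of_int m" using sqrt_pow_coprime[OF P x(2)] by simp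
  moreover have "\<not> int q dvd 2 * m" using q by (metis coprime_common_divisor dvd_refl not_prime_unit prime_int_nat_transfer nat_int of_nat_0_le_iff)
  ultimately have "ev (P \<circ>\<^sub>p monom 1 x) (w ^ q) = of_int (Legendre m q) * ev (P \<circ>\<^sub>p monom 1 x) w"
    by (rule sqrt_pow_prime[OF _ q(1,2)])
  hence "ev P (w ^ (q * x)) = of_int (Legendre m q) * ev P (w ^ x)" by (simp add: power_mult)
  thus ?case unfolding factor.IH[OF x] Jacobi_prime_mult[OF q(1) x(1)] by simp
qed auto

end

subsection \<open>Square roots in cyclotomic fields\<close>

lemma primitive_root_inj:
  assumes "primitive_root_of_unity n z" "n > 0" "i < n" "j < n" "z ^ i = z ^ j"
  shows "i = j"
proof -
  have z: "z \<noteq> 0" using assms(1,2) by (auto simp: primitive_root_of_unity_def power_0_left)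
  have False if "i < j" "j < n" "z ^ i = z ^ j" for i j
  proof -
    have "z ^ i * z ^ (j - i) = z ^ (i + (j - i))" by (rule power_add[symmetric])
    hence "z ^ i * z ^ (j - i) = z ^ i * 1" using that by simp
    hence "z ^ (j - i) = 1" using z by simp
    thus False using assms(1) that unfolding primitive_root_of_unity_def by simp
  qed
  thus ?thesis using assms(3-5) by (metis linorder_neqE_nat)
qed

lemma primitive_root_surj:
  assumes "primitive_root_of_unity n z" "n > 0" "x ^ n = 1"
  shows "\<exists>j<n. x = z ^ j"
proof -
  have sub: "(\<lambda>j. z ^ j) ` {..<n} \<subseteq> {x. x ^ n = 1}"
  proof (intro subsetI, elim imageE)
    fix x j assume x: "x = z ^ j"
    have "x ^ n = (z ^ n) ^ j" unfolding x power_mult[symmetric] by (simp add: mult.commute)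
    thus "x \<in> {x. x ^ n = 1}" using assms(1) by (simp add: primitive_root_of_unity_def)
  qed
  have "inj_on (\<lambda>j. z ^ j) {..<n}" using primitive_root_inj[OF assms(1,2)] by (intro inj_onI) auto
  hence "card ((\<lambda>j. z ^ j) ` {..<n}) = card {x::complex. x ^ n = 1}"
    using assms(2) by (simp add: card_image card_roots_unity_eq)
  hence "(\<lambda>j. z ^ j) ` {..<n} = {x. x ^ n = 1}"
    using assms(2) by (intro card_subset_eq sub finite_roots_unity) auto
  thus ?thesis using assms(3) by auto
qed

text \<open>The polynomials \<open>\<Prod>(X - v ^ k)\<close> and
  \<open>1 + X + ... + X ^ (p - 1)\<close> are monic of degree \<open>p - 1\<close> with the same
  \<open>p - 1\<close> zeros; compare their values at 1.\<close>

lemma prod_one_minus_roots_unity: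
  fixes v :: complex
  assumes v: "primitive_root_of_unity p v" and p: "p > 1"
  shows "(\<Prod>k=1..<p. (1 - v ^ k)) = of_nat p"
proof -
  have v1: "v ^ p = 1" and v2: "\<And>k. 0 < k \<Longrightarrow> k < p \<Longrightarrow> v ^ k \<noteq> 1"
    using v by (auto simp: primitive_root_of_unity_def)
  have inj: "inj_on (\<lambda>k. v ^ k) {1..<p}"
    using primitive_root_inj[OF v] p by (intro inj_onI) auto
  define G :: "complex poly" where "G = (\<Sum>k<p. monom 1 k)"
  define F where "F = (\<Prod>k=1..<p. [:- (v ^ k), 1:])"
  have coeffG: "coeff G n = (if n < p then 1 else 0)" for n
    by (simp add: G_def coeff_sum)
  have degF: "degree F = p - 1" unfolding F_def by (subst degree_prod_eq_sum_degree) auto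
  have "F = G"
  proof (rule poly_eqI_degree_lead_coeff[where n = "p - 1" and A = "(\<lambda>k. v ^ k) ` {1..<p}"])
    show "coeff F (p - 1) = coeff G (p - 1)"
      using lead_coeff_prod[of "\<lambda>k. [:- (v ^ k), 1:]" "{1..<p}"] p degF
      unfolding F_def[symmetric] by (simp add: coeffG)
    show "p - 1 \<le> card ((\<lambda>k. v ^ k) ` {1..<p})" using inj by (simp add: card_image)
    show "degree G \<le> p - 1" by (intro degree_le) (auto simp: coeffG)
    fix x assume "x \<in> (\<lambda>k. v ^ k) ` {1..<p}"
    then obtain k where k: "1 \<le> k" "k < p" "x = v ^ k" by auto
    have "(1 - x) * (\<Sum>i<p. x ^ i) = 1 - x ^ p" by (rule one_diff_power_eq[symmetric])
    also have "x ^ p = 1" using k v1 by (metis power_mult mult.commute power_one)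
    finally have "(\<Sum>i<p. x ^ i) = 0" using v2[of k] k by simp
    thus "poly F x = poly G x" using k
      by (auto simp: F_def G_def poly_prod poly_sum poly_monom prod_zero_iff)
  qed (use degF in auto)
  hence "poly F 1 = poly G 1" by simp
  thus ?thesis by (simp add: F_def G_def poly_prod poly_sum poly_monom)
qed

text \<open>Pairing \<open>k\<close> with \<open>p - k\<close> through
  \<open>1 - v ^ (p - k) = - v ^ (p - k) * (1 - v ^ k)\<close> makes the product \<open>p\<close> a
  square in \<open>\<int>[v]\<close> up to the sign \<open>(-1) ^ h\<close>. This takes the place of
  the quadratic Gauss sum.\<close>

lemma prime_root_unity_square:
  fixes v :: complex
  assumes v: "primitive_root_of_unity p v" and p: "p = 2 * h + 1" "h > 0"
  shows "\<exists>e. of_nat p = (-1) ^ h * (v ^ e * (\<Prod>k=1..h. (1 - v ^ k))) ^ 2"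
proof -
  have v1: "v ^ p = 1" using v by (simp add: primitive_root_of_unity_def)
  define e where "e = (\<Sum>k=1..h. p - k)"
  have "(\<Prod>k=h+1..<p. (1 - v ^ k)) = (\<Prod>k=1..h. (1 - v ^ (p - k)))"
    by (rule prod.reindex_bij_witness[of _ "\<lambda>k. p - k" "\<lambda>k. p - k"]) (use p in auto)
  also have "\<dots> = (\<Prod>k=1..h. (-1) * v ^ (p - k) * (1 - v ^ k))"
  proof (intro prod.cong refl)
    fix k assume "k \<in> {1..h}"
    hence "v ^ (p - k) * v ^ k = 1" using v1 p by (simp flip: power_add)
    thus "1 - v ^ (p - k) = (-1) * v ^ (p - k) * (1 - v ^ k)" by (simp add: algebra_simps)
  qed
  also have "\<dots> = (-1) ^ h * v ^ e * (\<Prod>k=1..h. (1 - v ^ k))"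
    unfolding prod.distrib e_def power_sum by simp
  finally have 1: "(\<Prod>k=h+1..<p. (1 - v ^ k)) = (-1) ^ h * v ^ e * (\<Prod>k=1..h. (1 - v ^ k))" .
  have "(\<Prod>k=1..<p. (1 - v ^ k)) = of_nat p"
    using p by (intro prod_one_minus_roots_unity v) auto
  moreover have "(\<Prod>k=1..<p. (1 - v ^ k)) = (\<Prod>k\<in>{1..h} \<union> {h+1..<p}. (1 - v ^ k))"
    using p by (intro prod.cong) auto
  moreover have "\<dots> = (\<Prod>k=1..h. (1 - v ^ k)) * (\<Prod>k=h+1..<p. (1 - v ^ k))"
    by (intro prod.union_disjoint) auto
  ultimately have "of_nat p = (\<Prod>k=1..h. (1 - v ^ k)) * (\<Prod>k=h+1..<p. (1 - v ^ k))"
    by (simp only:)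
  also have "\<dots> = (-1) ^ h * (v ^ e * (\<Prod>k=1..h. (1 - v ^ k)) ^ 2)"
    unfolding 1 by (simp add: power2_eq_square)
  also have "v ^ e = (v ^ (e * (h + 1))) ^ 2" \<comment> \<open>\<open>v\<close> has odd order, hence is the square of one of its powers\<close>
  proof -
    have "(v ^ (e * (h + 1))) ^ 2 = v ^ (p * e + e)" by (simp add: p algebra_simps flip: power_mult)
    thus ?thesis by (simp add: power_add power_mult v1)
  qed
  finally show ?thesis by (metis power_mult_distrib)
qed

section \<open>Square roots of integers in \<open>\<int>[w]\<close> when 8 divides the order of
  \<open>w\<close>\<close>

locale primitive_root8 =
  fixes w :: complex and N :: nat
  assumes N_pos: "N > 0" and N8: "8 dvd N" and prim: "primitive_root_of_unity N w"
begin

sublocale root_of_unity w N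
  using N_pos prim by unfold_locales (auto simp: primitive_root_of_unity_def)

lemma power_neq_1: "0 < k \<Longrightarrow> k < N \<Longrightarrow> w ^ k \<noteq> 1"
  using prim by (auto simp: primitive_root_of_unity_def)

lemma power_half: "w ^ (N div 2) = -1"
proof -
  have "N div 2 * 2 = N" using N8 by auto
  hence "(w ^ (N div 2)) ^ 2 = 1" using root by (metis power_mult)
  moreover have "w ^ (N div 2) \<noteq> 1" using N_pos N8 by (intro power_neq_1) auto
  ultimately show ?thesis by (simp add: power2_eq_1_iff)
qed

definition is_square :: "int \<Rightarrow> bool" where
  "is_square m \<longleftrightarrow> (\<exists>P. ev P w ^ 2 = of_int m)"

lemma is_square_mult: "is_square a \<Longrightarrow> is_square b \<Longrightarrow> is_square (a * b)"
  unfolding is_square_def by (metis ev_mult of_int_mult power_mult_distrib)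

lemma is_square_minus_1: "is_square (-1)"
  unfolding is_square_def
proof
  have "N div 4 * 2 = N div 2" using N8 by auto
  thus "ev (monom 1 (N div 4)) w ^ 2 = of_int (-1)"
    using power_half by (simp flip: power_mult)
qed

lemma is_square_2: "is_square 2"
  unfolding is_square_def
proof
  \<comment> \<open>A primitive eighth root of unity. Since \<open>x ^ 4 = -1\<close>, the witness
    \<open>x - x ^ 3\<close> equals \<open>x + 1 / x\<close>, a square root of 2.\<close>
  define x where "x = w ^ (N div 8)"
  have "N div 8 * 4 = N div 2" using N8 by auto
  hence x4: "x ^ 4 = -1" using power_half by (simp add: x_def flip: power_mult)
  have "ev (monom 1 (N div 8) - monom 1 (N div 8) ^ 3) w ^ 2 = (x - x ^ 3) ^ 2" by (simp add: x_def)
  also have "\<dots> = x ^ 2 - 2 * x ^ 4 + x ^ 2 * x ^ 4"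
    by (simp add: power2_diff flip: power_mult power_add power_Suc)
  finally show "ev (monom 1 (N div 8) - monom 1 (N div 8) ^ 3) w ^ 2 = of_int 2" by (simp add: x4)
qed

lemma is_square_odd_prime:
  assumes "prime p" "p dvd N" "p \<noteq> 2"
  shows "is_square (int p)"
proof -
  define v where "v = w ^ (N div p)"
  have p2: "p > 2" using prime_ge_2_nat[OF assms(1)] assms(3) by simp
  hence "odd p" using assms by (intro prime_odd_nat) auto
  then obtain h where h: "p = 2 * h + 1" by (elim oddE)
  have v1: "v ^ p = 1" using assms(2) root by (simp add: v_def flip: power_mult)
  have v2: "v ^ k \<noteq> 1" if "0 < k" "k < p" for k
  proof -
    have pos: "N div p > 0" using assms(2) N_pos by auto
    hence "N div p * k < N div p * p" using that by (intro mult_strict_left_mono) auto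
    hence "w ^ (N div p * k) \<noteq> 1" using that assms(2) pos by (intro power_neq_1) auto
    thus ?thesis by (simp add: v_def power_mult)
  qed
  have v: "primitive_root_of_unity p v" using v1 v2 by (simp add: primitive_root_of_unity_def)
  obtain e where e: "of_nat p = (-1) ^ h * (v ^ e * (\<Prod>k=1..h. (1 - v ^ k))) ^ 2"
    using prime_root_unity_square[OF v h] p2 h by fastforce
  \<comment> \<open>The sign can be absorbed because -1 has a square root in
    \<open>\<int>[w]\<close>.\<close>
  have "is_square ((-1) ^ h)"
  proof (induction h)
    case 0
    show ?case unfolding is_square_def by (intro exI[of _ 1]) simp
  next
    case (Suc h)
    thus ?case unfolding power_Suc by (intro is_square_mult is_square_minus_1)
  qed
  then obtain R where R: "ev R w ^ 2 = of_int ((-1) ^ h)" unfolding is_square_def by blast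
  have "ev (R * (monom 1 (N div p) ^ e * (\<Prod>k=1..h. 1 - monom 1 (N div p) ^ k))) w ^ 2 = of_int (int p)"
    using R by (simp add: e power_mult_distrib v_def)
  thus ?thesis unfolding is_square_def by blast
qed

lemma is_square_if_primes_dvd:
  assumes "m \<noteq> 0" "\<And>p. prime p \<Longrightarrow> int p dvd m \<Longrightarrow> p dvd N"
  shows "is_square m"
  using assms
proof (induction m rule: prime_divisors_induct)
  case (unit x)
  hence "x = 1 \<or> x = -1" by auto
  moreover have "is_square 1" unfolding is_square_def by (intro exI[of _ 1]) simp
  ultimately show ?case using is_square_minus_1 by auto
next
  case (factor p x)
  have x: "is_square x" using factor by (metis dvd_mult mult_zero_right)
  have p: "prime (nat p)" "int (nat p) = p" using factor(1) by (auto simp: prime_ge_0_int)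
  hence "nat p dvd N" using factor by (metis dvd_triv_left)
  hence "is_square p" using is_square_odd_prime[of "nat p"] is_square_2 p by (cases "nat p = 2") auto
  thus ?case using x by (intro is_square_mult)
qed auto

end

subsection \<open>Linear systems over the field with two elements\<close>

text \<open>The proof is Gaussian elimination: \<open>b\<close> is the pivot for the unknown \<open>p0\<close>.\<close>

lemma sign_system_solvable:
  fixes c :: "'a \<Rightarrow> int" and e :: "'a \<Rightarrow> 'b \<Rightarrow> nat"
  assumes "finite P" "finite S" "\<And>a. a \<in> S \<Longrightarrow> c a \<in> {-1, 1}"
    "\<And>T. T \<subseteq> S \<Longrightarrow> (\<And>p. p \<in> P \<Longrightarrow> even (\<Sum>a\<in>T. e a p)) \<Longrightarrow> (\<Prod>a\<in>T. c a) = 1"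
  shows "\<exists>\<epsilon>. (\<forall>p\<in>P. \<epsilon> p \<in> {-1, 1}) \<and> (\<forall>a\<in>S. (\<Prod>p\<in>P. \<epsilon> p ^ e a p) = c a)"
  using assms
proof (induction P arbitrary: S c e)
  case empty
  have "c a = 1" if "a \<in> S" for a using empty(3)[of "{a}"] that by simp
  thus ?case by simp
next
  case (insert p0 P)
  show ?case
  proof (cases "\<exists>b\<in>S. odd (e b p0)")
    \<comment> \<open>All exponents of \<open>p0\<close> are even, so either sign would do for it; 1
      is chosen.\<close>
    case False
    have "\<exists>\<epsilon>. (\<forall>p\<in>P. \<epsilon> p \<in> {-1, 1}) \<and> (\<forall>a\<in>S. (\<Prod>p\<in>P. \<epsilon> p ^ e a p) = c a)"
    proof (rule insert.IH)
      fix T assume T: "T \<subseteq> S" "\<And>p. p \<in> P \<Longrightarrow> even (\<Sum>a\<in>T. e a p)"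
      have "even (\<Sum>a\<in>T. e a p0)" using T False by (intro dvd_sum) auto
      thus "(\<Prod>a\<in>T. c a) = 1" using T insert.prems by (intro insert.prems(3)) auto
    qed (use insert.prems in auto)
    then obtain \<epsilon> where \<epsilon>: "\<forall>p\<in>P. \<epsilon> p \<in> {-1, 1}" "\<forall>a\<in>S. (\<Prod>p\<in>P. \<epsilon> p ^ e a p) = c a"
      by blast
    show ?thesis
    proof (intro exI conjI ballI)
      fix p assume "p \<in> insert p0 P"
      thus "(\<epsilon>(p0 := 1)) p \<in> {-1, 1}" using \<epsilon> by auto
    next
      fix a assume "a \<in> S"
      have "(\<Prod>p\<in>P. (\<epsilon>(p0 := 1)) p ^ e a p) = (\<Prod>p\<in>P. \<epsilon> p ^ e a p)"
        using insert.hyps by (intro prod.cong) auto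
      thus "(\<Prod>p\<in>insert p0 P. (\<epsilon>(p0 := 1)) p ^ e a p) = c a"
        using insert.hyps \<epsilon> \<open>a \<in> S\<close> by simp
    qed
  next
    case True
    then obtain b where b: "b \<in> S" "odd (e b p0)" by blast
    define S' where "S' = S - {b}"
    \<comment> \<open>Every equation with an odd exponent of \<open>p0\<close> is multiplied by the
      pivot equation. This makes the exponent of \<open>p0\<close> even and so eliminates that
      unknown.\<close>
    define e' where "e' = (\<lambda>a p. e a p + (if odd (e a p0) then e b p else 0))"
    define c' where "c' = (\<lambda>a. c a * (if odd (e a p0) then c b else 1))"
    have S': "finite S'" "S' \<subseteq> S" "b \<notin> S'" using insert.prems by (auto simp: S'_def)
    have "\<exists>\<epsilon>. (\<forall>p\<in>P. \<epsilon> p \<in> {-1, 1}) \<and> (\<forall>a\<in>S'. (\<Prod>p\<in>P. \<epsilon> p ^ e' a p) = c' a)"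
    proof (rule insert.IH)
      fix a assume "a \<in> S'"
      thus "c' a \<in> {-1, 1}" using insert.prems(2)[of a] insert.prems(2)[OF b(1)] S' by (auto simp: c'_def)
    next
      fix T assume T: "T \<subseteq> S'" "\<And>p. p \<in> P \<Longrightarrow> even (\<Sum>a\<in>T. e' a p)"
      have fT: "finite T" using T S' finite_subset by blast
      define k where "k = card {a \<in> T. odd (e a p0)}"
      have sum_e': "(\<Sum>a\<in>T. e' a p) = (\<Sum>a\<in>T. e a p) + k * e b p" for p
        using fT by (simp add: e'_def sum.distrib k_def flip: sum.inter_filter)
      have prod_c': "(\<Prod>a\<in>T. c' a) = (\<Prod>a\<in>T. c a) * c b ^ k"
        using fT by (simp add: c'_def prod.distrib k_def flip: prod.inter_filter)
      have k: "even (\<Sum>a\<in>T. e a p0) \<longleftrightarrow> even k"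
        using fT by (simp add: even_sum_iff k_def)
      have cb: "c b ^ k = (if even k then 1 else c b)"
        using insert.prems(2)[OF b(1)] by auto
      show "(\<Prod>a\<in>T. c' a) = 1"
      proof (cases "even k")
        case True
        have "(\<Prod>a\<in>T. c a) = 1"
        proof (rule insert.prems(3))
          fix p assume "p \<in> insert p0 P"
          thus "even (\<Sum>a\<in>T. e a p)" using T(2)[of p] sum_e'[of p] k True by auto
        qed (use T S' in auto)
        thus ?thesis by (simp add: prod_c' cb True)
      next
        case False
        have bT: "b \<notin> T" using T S' by auto
        \<comment> \<open>The pivot row enters the reduced rows of \<open>T\<close> an odd number of
          times, so the corresponding set of original rows is \<open>T\<close> together with
          \<open>b\<close>.\<close>
        have "(\<Prod>a\<in>insert b T. c a) = 1"
        proof (rule insert.prems(3))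
          fix p assume "p \<in> insert p0 P"
          thus "even (\<Sum>a\<in>insert b T. e a p)"
            using T(2)[of p] sum_e'[of p] k False b(2) fT bT by auto
        qed (use T S' b in auto)
        thus ?thesis using fT bT by (simp add: prod_c' cb False mult.commute)
      qed
    qed (use S' in auto)
    then obtain \<epsilon> where \<epsilon>: "\<forall>p\<in>P. \<epsilon> p \<in> {-1, 1}" "\<forall>a\<in>S'. (\<Prod>p\<in>P. \<epsilon> p ^ e' a p) = c' a"
      by blast
    define E where "E = (\<lambda>a. \<Prod>p\<in>P. \<epsilon> p ^ e a p)"
    have E: "E a \<in> {-1, 1}" for a
    proof -
      have "\<bar>\<epsilon> p\<bar> = 1" if "p \<in> P" for p using \<epsilon>(1) that by auto
      hence "\<bar>E a\<bar> = 1" unfolding E_def abs_prod power_abs by simp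
      thus ?thesis by auto
    qed
    \<comment> \<open>The pivot equation forces this value, as \<open>e b p0\<close> is odd and
      \<open>E b\<close> is its own inverse.\<close>
    define \<epsilon>' where "\<epsilon>' = \<epsilon>(p0 := c b * E b)"
    have x: "c b * E b \<in> {-1, 1}" using E[of b] insert.prems(2)[OF b(1)] by auto
    show ?thesis
    proof (intro exI conjI ballI)
      fix p assume "p \<in> insert p0 P"
      thus "\<epsilon>' p \<in> {-1, 1}" using \<epsilon>(1) x by (cases "p = p0") (auto simp: \<epsilon>'_def)
    next
      fix a assume a: "a \<in> S"
      have "(\<Prod>p\<in>P. \<epsilon>' p ^ e a p) = E a"
        unfolding E_def using insert.hyps by (intro prod.cong) (auto simp: \<epsilon>'_def)
      hence "(\<Prod>p\<in>insert p0 P. \<epsilon>' p ^ e a p) = (c b * E b) ^ e a p0 * E a"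
        using insert.hyps by (simp add: \<epsilon>'_def)
      also have "(c b * E b) ^ e a p0 = (if even (e a p0) then 1 else c b * E b)"
        using x by auto
      also have "\<dots> * E a = c a"
      proof (cases "a = b")
        case True
        thus ?thesis using b E[of b] by auto
      next
        case False
        hence "(\<Prod>p\<in>P. \<epsilon> p ^ e' a p) = c' a" using \<epsilon>(2) a by (simp add: S'_def)
        moreover have "(\<Prod>p\<in>P. \<epsilon> p ^ e' a p) = E a * (if odd (e a p0) then E b else 1)"
          by (simp add: e'_def E_def power_add prod.distrib)
        ultimately show ?thesis using insert.prems(2)[OF b(1)] E[of b]
          by (auto simp: c'_def split: if_splits)
      qed
      finally show "(\<Prod>p\<in>insert p0 P. \<epsilon>' p ^ e a p) = c a" .
    qed
  qed
qed

subsection \<open>Legendre and Jacobi symbols\<close>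

lemma Legendre_values: "\<not> int p dvd a \<Longrightarrow> Legendre a (int p) \<in> {-1, 1}"
  by (auto simp: Legendre_def cong_0_iff)

text \<open>Two numbers in \<open>{-1, 0, 1}\<close> differ by at most 2, so a congruence modulo
  \<open>p > 2\<close> is an equality.\<close>

lemma Legendre_eqI:
  assumes "prime p" "p > 2" "[Legendre a (int p) = x] (mod int p)" "x \<in> {-1, 0, 1}"
  shows "Legendre a (int p) = x"
proof -
  have "int p dvd Legendre a (int p) - x" using assms(3) by (simp add: cong_iff_dvd_diff)
  moreover have "\<bar>Legendre a (int p) - x\<bar> \<le> 2" using assms(4) by (auto simp: Legendre_def)
  ultimately have "Legendre a (int p) - x = 0" using assms(2) by (metis zdvd_not_zless abs_of_nat dvd_imp_le_int less_le_not_le nat_int_comparison(2) of_nat_numeral order.trans)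
  thus ?thesis by simp
qed

lemma Legendre_mult:
  assumes "prime p" "p > 2"
  shows "Legendre (a * b) (int p) = Legendre a (int p) * Legendre b (int p)"
proof (rule Legendre_eqI[OF assms])
  have "[Legendre (a * b) (int p) = (a * b) ^ ((p - 1) div 2)] (mod int p)"
    by (rule euler_criterion[OF assms])
  also have "(a * b) ^ ((p - 1) div 2) = a ^ ((p - 1) div 2) * b ^ ((p - 1) div 2)"
    by (rule power_mult_distrib)
  also have "[\<dots> = Legendre a (int p) * Legendre b (int p)] (mod int p)"
    by (intro cong_mult cong_sym[OF euler_criterion[OF assms]])
  finally show "[Legendre (a * b) (int p) = Legendre a (int p) * Legendre b (int p)] (mod int p)" .
qed (auto simp: Legendre_def)

lemma Legendre_cong:
  assumes "[a = b] (mod p)"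
  shows "Legendre a p = Legendre b p"
proof -
  have "[a = 0] (mod p) \<longleftrightarrow> [b = 0] (mod p)" "QuadRes p a \<longleftrightarrow> QuadRes p b"
    using assms unfolding QuadRes_def by (meson cong_sym cong_trans)+
  thus ?thesis by (simp add: Legendre_def)
qed

lemma Legendre_one: "prime p \<Longrightarrow> Legendre 1 (int p) = 1"
  by (auto simp: Legendre_def cong_0_iff QuadRes_def intro: exI[of _ 1])

lemma Jacobi_mult:
  assumes "f \<noteq> 0" "odd f"
  shows "Jacobi (a * b) (int f) = Jacobi a (int f) * Jacobi b (int f)"
  using assms
proof (induction f rule: prime_divisors_induct)
  case (factor p x)
  hence x: "x \<noteq> 0" "odd x" and p: "p > 2" using prime_gt_1_nat[of p] by (cases "p = 2"; force)+
  show ?case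
    unfolding Jacobi_prime_mult[OF factor(1) x(1)] Legendre_mult[OF factor(1) p] factor.IH[OF x] by simp
qed auto

lemma Jacobi_one [simp]: "f \<noteq> 0 \<Longrightarrow> Jacobi 1 (int f) = 1"
proof (induction f rule: prime_divisors_induct)
  case (factor p x)
  hence x: "x \<noteq> 0" by auto
  show ?case unfolding Jacobi_prime_mult[OF factor(1) x] Legendre_one[OF factor(1)] factor.IH[OF x] by simp
qed auto

lemma Jacobi_prod:
  assumes "f \<noteq> 0" "odd f"
  shows "Jacobi (\<Prod>i\<in>I. F i) (int f) = (\<Prod>i\<in>I. Jacobi (F i) (int f))"
  by (induction I rule: infinite_finite_induct) (simp_all add: Jacobi_mult assms odd_pos)

lemma Jacobi_power:
  assumes "f \<noteq> 0" "odd f"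
  shows "Jacobi (a ^ k) (int f) = Jacobi a (int f) ^ k"
  by (induction k) (simp_all add: Jacobi_mult assms odd_pos)

lemma Jacobi_values:
  assumes "f \<noteq> 0" "coprime a (int f)"
  shows "Jacobi a (int f) \<in> {-1, 1}"
  using assms
proof (induction f rule: prime_divisors_induct)
  case (factor p x)
  hence x: "x \<noteq> 0" "coprime a (int x)" by auto
  have "\<not> int p dvd a" using factor by (metis coprime_common_divisor dvd_triv_left of_nat_mult not_prime_unit prime_nat_int_transfer)
  hence "Legendre a (int p) \<in> {-1, 1}" by (rule Legendre_values)
  thus ?case using factor.IH[OF x] Jacobi_prime_mult[OF factor(1) x(1), of a] by auto
qed auto

text \<open>For odd \<open>p\<close> and \<open>g\<close> this is the sign
  \<open>(-1) ^ ((p - 1) div 2 * ((g - 1) div 2))\<close>, in a form that visibly depends only on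
  residues modulo 4.\<close>

definition reciprocity_sign :: "nat \<Rightarrow> nat \<Rightarrow> int" where
  "reciprocity_sign p g = (if p mod 4 = 3 \<and> g mod 4 = 3 then -1 else 1)"

text \<open>Quadratic reciprocity for each prime factor of \<open>g\<close>, put together by
  multiplicativity of the sign in odd \<open>g\<close>.\<close>

lemma Jacobi_reciprocity:
  assumes "prime p" "p > 2" "g \<noteq> 0" "odd g" "coprime p g"
  shows "Jacobi (int p) (int g) = Legendre (int g) (int p) * reciprocity_sign p g"
  using assms(3-)
proof (induction g rule: prime_divisors_induct)
  case (unit x)
  thus ?case by (simp add: Legendre_one[OF assms(1)] reciprocity_sign_def)
next
  case (factor q x)
  hence x: "x \<noteq> 0" "odd x" "coprime p x" and q: "odd q" "coprime p q" by auto
  have q2: "q > 2" using q prime_gt_1_nat[OF factor(1)] by (cases "q = 2") auto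
  have odd: "odd p" using assms by (intro prime_odd_nat) auto
  have pq: "p \<noteq> q" using q(2) factor(1) by auto
  have ndvd: "\<not> int p dvd int q"
    using pq assms(1) factor(1) by (simp add: primes_dvd_imp_eq) (metis primes_dvd_imp_eq)
  have "even ((p - 1) div 2) \<longleftrightarrow> p mod 4 = 1" "even ((q - 1) div 2) \<longleftrightarrow> q mod 4 = 1"
    using odd q by presburger+
  moreover have 1: "p mod 4 = 1 \<or> p mod 4 = 3" "q mod 4 = 1 \<or> q mod 4 = 3" "x mod 4 = 1 \<or> x mod 4 = 3"
    using odd q x by presburger+
  ultimately have "(-1::int) ^ ((p - 1) div 2 * ((q - 1) div 2)) = reciprocity_sign p q"
    by (auto simp: reciprocity_sign_def power_mult)
  hence "Legendre p q * Legendre q p = reciprocity_sign p q"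
    using Quadratic_Reciprocity[OF assms(1,2) factor(1) q2 pq] by simp
  hence L: "Legendre p q = Legendre q p * reciprocity_sign p q"
    using Legendre_values[OF ndvd] by auto
  have "(q * x) mod 4 = ((q mod 4) * (x mod 4)) mod 4" by (simp add: mod_mult_eq)
  hence "reciprocity_sign p (q * x) = reciprocity_sign p q * reciprocity_sign p x"
    using 1 by (auto simp: reciprocity_sign_def)
  thus ?case unfolding Jacobi_prime_mult[OF factor(1) x(1)] L factor.IH[OF x]
    by (simp add: Legendre_mult[OF assms(1,2)])
qed auto

text \<open>Otherwise squaring would map the nonzero residues onto themselves and so be injective,
  although 1 and \<open>p - 1\<close> have the same square.\<close>

lemma quadratic_nonresidue_exists:
  assumes "prime p" "p > 2"
  shows "\<exists>r::nat. Legendre (int r) (int p) = -1"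
proof (rule ccontr)
  assume "\<nexists>r::nat. Legendre (int r) (int p) = -1"
  hence res: "QuadRes (int p) (int r)" if "r \<in> {1..<p}" for r
    using that Legendre_def[of "int r" "int p"] by (auto simp: cong_0_iff split: if_splits dest: zdvd_imp_le)
  have "{1..<p} \<subseteq> (\<lambda>y. (y * y) mod p) ` {1..<p}"
  proof
    fix r assume r: "r \<in> {1..<p}"
    then obtain y where y: "[y\<^sup>2 = int r] (mod int p)" using res unfolding QuadRes_def by blast
    define z where "z = nat (y mod int p)"
    have "int ((z * z) mod p) = (y mod int p) * (y mod int p) mod int p"
      using assms by (simp add: z_def zmod_int)
    also have "\<dots> = y\<^sup>2 mod int p" by (simp add: mod_mult_eq power2_eq_square)
    also have "\<dots> = int r" using y r by (simp add: cong_def)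
    finally have "(z * z) mod p = r" by simp
    moreover have "z < p" using assms by (simp add: z_def nat_less_iff)
    moreover have "z \<noteq> 0" using \<open>(z * z) mod p = r\<close> r by (auto intro: ccontr)
    ultimately show "r \<in> (\<lambda>y. (y * y) mod p) ` {1..<p}" by auto
  qed
  hence "card {1..<p} \<le> card ((\<lambda>y. (y * y) mod p) ` {1..<p})" by (intro card_mono) auto
  hence "inj_on (\<lambda>y. (y * y) mod p) {1..<p}"
    by (intro eq_card_imp_inj_on antisym card_image_le) auto
  moreover have "((p - 1) * (p - 1)) mod p = (1 * 1) mod p"
  proof -
    obtain n where n: "p = n + 2" using assms by (metis add.commute less_imp_add_positive)
    have "(p - 1) * (p - 1) = p * n + 1 * 1" by (simp add: n algebra_simps)
    thus ?thesis by (simp only: mod_mult_self4)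
  qed
  ultimately have "p - 1 = 1" using assms by (elim inj_onD) auto
  thus False using assms by simp
qed

subsection \<open>Units with prescribed Jacobi symbols\<close>

lemma squarefree_dvd_if_primes_dvd:
  fixes m n :: int
  assumes "squarefree m" "\<And>p. prime p \<Longrightarrow> p dvd m \<Longrightarrow> p dvd n"
  shows "m dvd n"
  using assms
proof (induction m rule: prime_divisors_induct)
  case (factor p x)
  have "x dvd n" using factor by (meson dvd_mult squarefree_multD(2))
  moreover have "p dvd n" using factor by simp
  moreover have "\<not> p dvd x"
  proof
    assume "p dvd x"
    hence "p\<^sup>2 dvd p * x" by (simp add: power2_eq_square)
    thus False using factor by (meson squarefreeD not_prime_unit)
  qed
  hence "coprime p x" using factor(1) by (simp add: prime_imp_coprime)
  ultimately show ?case by (simp add: divides_mult)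
qed (auto simp: unit_imp_dvd simp del: zdvd1_eq)

text \<open>The exponents \<open>e\<close> will be the coefficients of the linear system; the
  cofactor \<open>u\<close> keeps the sign and all primes outside \<open>P\<close>.\<close>

lemma extract_prime_powers:
  fixes a :: int
  assumes "finite P" "a \<noteq> 0" "\<And>p. p \<in> P \<Longrightarrow> prime p"
  shows "\<exists>u e. a = u * (\<Prod>p\<in>P. int p ^ e p) \<and> (\<forall>p\<in>P. \<not> int p dvd u)"
  using assms
proof (induction P)
  case empty
  show ?case by (intro exI[of _ a]) auto
next
  case (insert q P)
  then obtain u e where u: "a = u * (\<Prod>p\<in>P. int p ^ e p)" "\<forall>p\<in>P. \<not> int p dvd u" by auto
  have "u \<noteq> 0" using u insert by auto
  moreover have "\<not> is_unit (int q)" using insert.prems(2)[of q] by auto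
  ultimately obtain v where v: "u = int q ^ multiplicity (int q) u * v" "\<not> int q dvd v"
    by (metis multiplicity_decompose')
  have "(\<Prod>p\<in>P. int p ^ (e(q := multiplicity (int q) u)) p) = (\<Prod>p\<in>P. int p ^ e p)"
    using insert.hyps by (intro prod.cong) auto
  hence "a = v * (\<Prod>p\<in>insert q P. int p ^ (e(q := multiplicity (int q) u)) p)"
    using insert.hyps by (simp add: u(1)) (subst v(1), simp)
  moreover have "\<not> int p dvd v" if "p \<in> insert q P" for p
    using that u(2) v by (metis dvd_mult insert_iff)
  ultimately show ?case by blast
qed

lemma sqf_prod_decomposition:
  fixes T :: "int set"
  assumes "finite T" "0 \<notin> T"
  obtains k where "\<Prod>T = sqf T * k\<^sup>2" "k \<noteq> 0" "squarefree (sqf T)" "sqf T \<noteq> 0"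
proof
  show "\<Prod>T = sqf T * (square_part (\<Prod>T))\<^sup>2"
    unfolding sqf_def by (rule squarefree_decompose)
  moreover have "\<Prod>T \<noteq> 0" using assms by auto
  ultimately show "square_part (\<Prod>T) \<noteq> 0" by auto
  show "squarefree (sqf T)" "sqf T \<noteq> 0" unfolding sqf_def by auto
qed

lemma not_coprime_common_prime:
  fixes a b :: int
  assumes "\<not> coprime a b" "b \<noteq> 0"
  obtains q :: nat where "prime q" "int q dvd a" "int q dvd b"
proof -
  obtain c where c: "c dvd a" "c dvd b" "\<not> is_unit c" using assms(1) by (rule not_coprimeE)
  have "c \<noteq> 0" using c assms(2) by auto
  then obtain p where p: "p dvd c" "prime p" using c(3) prime_divisor_exists by metis
  have "prime (nat p)" "int (nat p) = p" using p(2) by (auto simp: prime_ge_0_int)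
  thus ?thesis using that[of "nat p"] p c by (metis dvd_trans)
qed

section \<open>Properties of Jacobi symbols read off from the action on square roots\<close>

context primitive_root8
begin

text \<open>Coprimality of \<open>g\<close> to \<open>2 * m\<close> follows from coprimality to
  \<open>N\<close>, since 2 and all primes dividing \<open>m\<close> divide
  \<open>N\<close>.\<close>

lemma sqrt_pow_eq_Jacobi:
  assumes "m \<noteq> 0" "\<And>p. prime p \<Longrightarrow> int p dvd m \<Longrightarrow> p dvd N"
    and "ev P w ^ 2 = of_int m" "coprime g N" "g \<noteq> 0"
  shows "ev P (w ^ g) = of_int (Jacobi m (int g)) * ev P w"
proof (rule sqrt_pow_Jacobi)
  show "coprime (int g) (2 * m)"
  proof (rule ccontr)
    assume "\<not> coprime (int g) (2 * m)"
    then obtain q where q: "prime q" "int q dvd int g" "int q dvd 2 * m"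
      using assms(1) not_coprime_common_prime[of "int g" "2 * m"] by auto
    have "q dvd N"
    proof (cases "q = 2")
      case True
      thus ?thesis using N8 by auto
    next
      case False
      hence "\<not> int q dvd 2" using q(1) by (metis int_dvd_int_iff of_nat_numeral primes_dvd_imp_eq two_is_prime_nat)
      hence "int q dvd m" using q prime_dvd_multD[of "int q" 2 m] by auto
      thus ?thesis using assms(2) q(1) by blast
    qed
    thus False using q assms(4) by (metis coprime_common_divisor_nat int_dvd_int_iff not_prime_1)
  qed
qed (use assms in auto)

text \<open>The symbol is the factor by which \<open>w \<mapsto> w ^ g\<close> multiplies a square
  root of \<open>m\<close>, and \<open>w ^ g\<close> depends only on \<open>g\<close> modulo
  \<open>N\<close>.\<close>

lemma Jacobi_cong_mod:
  assumes "m \<noteq> 0" "\<And>p. prime p \<Longrightarrow> int p dvd m \<Longrightarrow> p dvd N"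
    and "coprime g N" "g \<noteq> 0" "h \<noteq> 0" "[g = h] (mod N)"
  shows "Jacobi m (int g) = Jacobi m (int h)"
proof -
  obtain P where P: "ev P w ^ 2 = of_int m"
    using is_square_if_primes_dvd[OF assms(1,2)] unfolding is_square_def by blast
  have "coprime h N" using cong_imp_coprime[OF assms(6,3)] .
  hence "of_int (Jacobi m (int g)) * ev P w = of_int (Jacobi m (int h)) * ev P w"
    using sqrt_pow_eq_Jacobi[OF assms(1,2) P assms(3,4)] sqrt_pow_eq_Jacobi[OF assms(1,2) P _ assms(5)]
      power_cong[OF assms(6)] by auto
  moreover have "ev P w \<noteq> 0" using P assms(1) by auto
  ultimately show ?thesis by simp
qed

text \<open>Square roots of \<open>m\<close> and \<open>n\<close> are rational multiples of each
  other, so \<open>w \<mapsto> w ^ g\<close> multiplies both by the same sign.\<close>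

lemma Jacobi_square_class:
  assumes "m \<noteq> 0" "\<And>p. prime p \<Longrightarrow> int p dvd m \<Longrightarrow> p dvd N"
    and "n \<noteq> 0" "\<And>p. prime p \<Longrightarrow> int p dvd n \<Longrightarrow> p dvd N"
    and "m * k\<^sup>2 = n * l\<^sup>2" "k \<noteq> 0" and g: "coprime g N" "g \<noteq> 0"
  shows "Jacobi m (int g) = Jacobi n (int g)"
proof -
  obtain P Q where P: "ev P w ^ 2 = of_int m" and Q: "ev Q w ^ 2 = of_int n"
    using is_square_if_primes_dvd[OF assms(1,2)] is_square_if_primes_dvd[OF assms(3,4)]
    unfolding is_square_def by blast
  have "of_int m * of_int k ^ 2 = (of_int n * of_int l ^ 2 :: complex)"
    using arg_cong[OF assms(5), of "of_int :: int \<Rightarrow> complex"] by simp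
  hence "(of_int k * ev P w) ^ 2 = (of_int l * ev Q w) ^ 2"
    unfolding power_mult_distrib P Q by (simp only: mult.commute)
  hence "of_int k * ev P w = of_int l * ev Q w \<or> of_int k * ev P w = of_int (- l) * ev Q w"
    unfolding power2_eq_iff by simp
  then obtain s where s: "of_int k * ev P w = of_int s * ev Q w" by blast
  have kP: "of_int k * ev P w \<noteq> 0" using P assms(1,6) by auto
  have "of_int k * ev P (w ^ g) = of_int s * ev Q (w ^ g)"
    using root_pow_coprime[of "smult k P - smult s Q" g] s g by simp
  hence "of_int (Jacobi m (int g)) * (of_int k * ev P w) = of_int (Jacobi n (int g)) * (of_int s * ev Q w)"
    using sqrt_pow_eq_Jacobi[OF assms(1,2) P g] sqrt_pow_eq_Jacobi[OF assms(3,4) Q g]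
    by (simp add: ac_simps)
  thus ?thesis unfolding s(1)[symmetric] using kP by simp
qed

text \<open>A prime outside \<open>N\<close> can enter \<open>\<Prod>T\<close> only through
  \<open>l\<^sup>2\<close>, hence with even multiplicity, and so is absent from the squarefree
  part.\<close>

lemma sqf_dvd_if_even_exponents:
  assumes T: "finite T" "0 \<notin> T" and eq: "\<Prod>T = U * l\<^sup>2"
    and ndvd: "\<And>p. prime p \<Longrightarrow> int p dvd \<Prod>T \<Longrightarrow> \<not> p dvd N \<Longrightarrow> \<not> int p dvd U"
  shows "sqf T dvd int N"
proof -
  obtain k where k: "\<Prod>T = sqf T * k\<^sup>2" "k \<noteq> 0" "squarefree (sqf T)" "sqf T \<noteq> 0"
    using sqf_prod_decomposition[OF T] by blast
  have nz: "U \<noteq> 0" "l \<noteq> 0" using k eq by auto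
  show ?thesis
  proof (rule squarefree_dvd_if_primes_dvd[OF k(3)])
    fix p :: int assume p: "prime p" "p dvd sqf T"
    define q where "q = nat p"
    have q: "prime q" "p = int q" using p(1) by (auto simp: q_def prime_ge_0_int)
    show "p dvd int N"
    proof (rule ccontr)
      assume "\<not> p dvd int N"
      hence "\<not> q dvd N" using q by simp
      hence "\<not> p dvd U" using ndvd[OF q(1)] p k(1) q(2) by (metis dvd_mult2)
      hence "multiplicity p (\<Prod>T) = 2 * multiplicity p l"
        unfolding eq using nz prime_imp_prime_elem[OF p(1)]
        by (simp add: prime_elem_multiplicity_mult_distrib prime_elem_multiplicity_power_distrib not_dvd_imp_multiplicity_0)
      moreover have "multiplicity p (\<Prod>T) = multiplicity p (sqf T) + 2 * multiplicity p k"
        unfolding k(1) using k(2,4) prime_imp_prime_elem[OF p(1)]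
        by (simp add: prime_elem_multiplicity_mult_distrib prime_elem_multiplicity_power_distrib)
      moreover have "multiplicity p (sqf T) = 1"
        using k(3) p squarefree_factorial_semiring''[of "sqf T"] k(4)
        by (smt (verit) le_antisym multiplicity_gt_zero_iff not_prime_unit One_nat_def Suc_leI in_prime_factors_iff)
      ultimately show False by presburger
    qed
  qed
qed

end

text \<open>Write each \<open>a\<close> as \<open>u a\<close> times powers of primes in
  \<open>P\<close>, the primes not dividing \<open>d\<close>. The symbol of \<open>u a\<close> over
  \<open>g\<close> is fixed by \<open>g \<equiv> f\<close> modulo \<open>d\<close>; the signs
  \<open>\<epsilon> p\<close>, to be the symbols of \<open>p \<in> P\<close> over \<open>g\<close>,
  are the unknowns of a linear system.\<close>

lemma exists_unit_with_Jacobi_values: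
  assumes S: "finite S" "0 \<notin> S"
    and d: "d > 0" "8 dvd d" "primitive_root_of_unity d z"
    and f: "f \<noteq> 0" "coprime f d"
    and \<theta>: "\<And>a. a \<in> S \<Longrightarrow> \<theta> a \<in> {-1, 1}"
    and D0: "\<And>T. T \<subseteq> S \<Longrightarrow> sqf T dvd int d \<Longrightarrow> (\<Prod>a\<in>T. \<theta> a) * Jacobi (sqf T) (int f) = 1"
  obtains g where "g \<noteq> 0" "coprime g (d * nat \<bar>\<Prod>S\<bar>)" "[g = f] (mod d)"
    "\<And>a. a \<in> S \<Longrightarrow> Jacobi a (int g) = \<theta> a"
proof -
  interpret primitive_root8 z d using d by unfold_locales
  have A0: "\<Prod>S \<noteq> 0" using S by auto
  define P where "P = {p. prime p \<and> int p dvd \<Prod>S \<and> \<not> p dvd d}"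
  have primeP: "p \<in> P \<Longrightarrow> prime p" for p by (simp add: P_def)
  have P2: "p > 2" if "p \<in> P" for p
  proof -
    have "2 dvd d" using d(2) by auto
    hence "p \<noteq> 2" using that by (auto simp: P_def)
    thus ?thesis using prime_ge_2_nat[OF primeP[OF that]] by simp
  qed
  have finP: "finite P"
  proof (rule finite_subset)
    show "P \<subseteq> {..nat \<bar>\<Prod>S\<bar>}" using A0 by (auto simp: P_def dest!: dvd_imp_le_int)
  qed auto
  have "\<exists>u e. a \<in> S \<longrightarrow> a = u * (\<Prod>p\<in>P. int p ^ e p) \<and> (\<forall>p\<in>P. \<not> int p dvd u)" for a
    using extract_prime_powers[OF finP, of a] primeP S by metis
  then obtain u e where ue: "\<And>a. a \<in> S \<Longrightarrow> a = u a * (\<Prod>p\<in>P. int p ^ e a p)"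
    "\<And>a p. a \<in> S \<Longrightarrow> p \<in> P \<Longrightarrow> \<not> int p dvd u a"
    by metis
  have u0: "u a \<noteq> 0" if "a \<in> S" for a using ue(1)[OF that] S that by auto
  have u_dvd: "u a dvd \<Prod>S" if "a \<in> S" for a
    using ue(1)[OF that] S that by (metis dvd_prodI dvd_mult_left)
  have u_primes: "p dvd d" if "a \<in> S" "prime p" "int p dvd u a" for a p
    using u_dvd[OF that(1)] ue(2)[OF that(1), of p] that by (auto simp: P_def dest: dvd_trans)
  have cop: "coprime (u a) (int f)" if "a \<in> S" for a
  proof (rule ccontr)
    assume "\<not> coprime (u a) (int f)"
    then obtain q where q: "prime q" "int q dvd u a" "int q dvd int f"
      using f(1) not_coprime_common_prime[of "u a" "int f"] by auto
    have "q dvd d" using u_primes[OF that] q by blast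
    thus False using f(2) q by (metis coprime_common_divisor_nat int_dvd_int_iff not_prime_1)
  qed
  have "2 dvd d" using d(2) by auto
  hence oddf: "odd f" using f(2) by (metis coprime_common_divisor odd_one)
  \<comment> \<open>The sign that the primes in \<open>P\<close> must contribute to the symbol of
    \<open>a\<close>; dividing by a sign is multiplying by it.\<close>
  define c where "c = (\<lambda>a. \<theta> a * Jacobi (u a) (int f))"
  have "\<exists>\<epsilon>. (\<forall>p\<in>P. \<epsilon> p \<in> {-1, 1}) \<and> (\<forall>a\<in>S. (\<Prod>p\<in>P. \<epsilon> p ^ e a p) = c a)"
  proof (rule sign_system_solvable[OF finP S(1)])
    fix a assume "a \<in> S"
    thus "c a \<in> {-1, 1}" using \<theta>[of a] Jacobi_values[OF f(1) cop, of a] by (auto simp: c_def)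
  next
    \<comment> \<open>A dependency among the equations says that \<open>\<Prod>T\<close> is
      \<open>U\<close> times a square, with all primes of \<open>U\<close> dividing
      \<open>d\<close>. So \<open>sqf T\<close> divides \<open>d\<close>, and the hypothesis
      \<open>D0\<close> is exactly the required consistency condition.\<close>
    fix T assume T: "T \<subseteq> S" and even: "\<And>p. p \<in> P \<Longrightarrow> even (\<Sum>a\<in>T. e a p)"
    have fT: "finite T" "0 \<notin> T" using T S finite_subset by auto
    define U where "U = (\<Prod>a\<in>T. u a)"
    define l where "l = (\<Prod>p\<in>P. int p ^ ((\<Sum>a\<in>T. e a p) div 2))"
    have "\<Prod>T = (\<Prod>a\<in>T. u a * (\<Prod>p\<in>P. int p ^ e a p))"
      using T ue(1) by (intro prod.cong) auto
    also have "\<dots> = U * (\<Prod>p\<in>P. int p ^ (\<Sum>a\<in>T. e a p))"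
      unfolding prod.distrib U_def power_sum by (subst (2) prod.swap) (rule refl)
    also have "(\<Prod>p\<in>P. int p ^ (\<Sum>a\<in>T. e a p)) = l\<^sup>2"
      unfolding l_def prod_power_distrib using even by (intro prod.cong) (auto simp flip: power_mult)
    finally have eq: "\<Prod>T = U * l\<^sup>2" .
    have U0: "U \<noteq> 0" using u0 T fT by (auto simp: U_def)
    have U_primes: "p dvd d" if "prime p" "int p dvd U" for p
      using that T fT u_primes by (auto simp: U_def prime_dvd_prod_iff)
    have dvd: "sqf T dvd int d"
      by (rule sqf_dvd_if_even_exponents[OF fT eq]) (use U_primes in blast)
    obtain k where k: "\<Prod>T = sqf T * k\<^sup>2" "k \<noteq> 0" "squarefree (sqf T)" "sqf T \<noteq> 0"
      using sqf_prod_decomposition[OF fT] by blast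
    have "Jacobi U (int f) = Jacobi (sqf T) (int f)"
    proof (rule Jacobi_square_class[OF U0 U_primes k(4)])
      show "U * l\<^sup>2 = sqf T * k\<^sup>2" using eq k by simp
      show "l \<noteq> 0" using eq k by auto
      show "p dvd d" if "prime p" "int p dvd sqf T" for p using that dvd by (metis dvd_trans int_dvd_int_iff)
    qed (use f in auto)
    moreover have "(\<Prod>a\<in>T. c a) = (\<Prod>a\<in>T. \<theta> a) * Jacobi U (int f)"
      by (simp add: c_def prod.distrib U_def Jacobi_prod[OF f(1) oddf])
    ultimately show "(\<Prod>a\<in>T. c a) = 1" using D0[OF T dvd] by simp
  qed
  then obtain \<epsilon> where \<epsilon>: "\<And>p. p \<in> P \<Longrightarrow> \<epsilon> p \<in> {-1, 1}" "\<And>a. a \<in> S \<Longrightarrow> (\<Prod>p\<in>P. \<epsilon> p ^ e a p) = c a"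
    by blast
  \<comment> \<open>Reciprocity translates the wanted symbol of \<open>p\<close> over
    \<open>g\<close> into a residue class of \<open>g\<close> modulo \<open>p\<close>. The sign is
    taken at \<open>f\<close>, since \<open>g\<close> will agree with \<open>f\<close> modulo
    4.\<close>
  have "\<exists>r::nat. p \<in> P \<longrightarrow> Legendre (int r) (int p) = \<epsilon> p * reciprocity_sign p f" for p
  proof (cases "p \<in> P")
    case True
    have "\<epsilon> p * reciprocity_sign p f \<in> {-1, 1}" using \<epsilon>(1)[OF True] by (auto simp: reciprocity_sign_def)
    thus ?thesis using quadratic_nonresidue_exists[OF primeP[OF True] P2[OF True]] Legendre_one[OF primeP[OF True]]
      by (metis empty_iff insert_iff of_nat_1)
  qed auto
  then obtain r :: "nat \<Rightarrow> nat" where r: "\<And>p. p \<in> P \<Longrightarrow> Legendre (int (r p)) (int p) = \<epsilon> p * reciprocity_sign p f"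
    by metis
  have dP: "d \<notin> P" by (simp add: P_def)
  \<comment> \<open>The modulus \<open>d\<close> joins the primes in \<open>P\<close>; the update
    \<open>r(d := f)\<close> asks for \<open>f\<close> there and is harmless because
    \<open>d\<close> is not in \<open>P\<close>.\<close>
  have "\<exists>g. \<forall>i\<in>insert d P. [g = (r(d := f)) i] (mod i)"
  proof (rule chinese_remainder_nat, safe)
    fix i j assume "i \<in> P" "j \<in> P" "i \<noteq> j"
    thus "coprime i j" using primeP primes_coprime by blast
  next
    fix i assume "i \<in> P" 
    hence "coprime i d" by (simp add: P_def prime_imp_coprime)
    thus "coprime i d" "coprime d i" by (simp_all add: coprime_commute)
  qed (use finP in auto)
  then obtain g where g: "[g = f] (mod d)" "\<And>p. p \<in> P \<Longrightarrow> [g = r p] (mod p)"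
    using dP by (metis fun_upd_other fun_upd_same insertCI)
  have "4 dvd d" using d(2) by presburger
  hence "[g = f] (mod 4)" using g(1) cong_dvd_modulus_nat by blast
  hence g4: "g mod 4 = f mod 4" by (simp add: cong_def)
  have gd: "coprime g d" by (rule cong_imp_coprime[OF cong_sym[OF g(1)] f(2)])
  have Leg: "Legendre (int g) (int p) = \<epsilon> p * reciprocity_sign p g" if "p \<in> P" for p
  proof -
    have "[int g = int (r p)] (mod int p)" using g(2)[OF that] by (simp add: cong_int_iff)
    thus ?thesis using r[OF that] g4 Legendre_cong[of "int g" "int (r p)" "int p"]
      by (simp add: reciprocity_sign_def)
  qed
  have pg: "\<not> p dvd g" if "p \<in> P" for p
  proof
    assume "p dvd g"
    hence "Legendre (int g) (int p) = 0" by (simp add: Legendre_def cong_0_iff)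
    thus False using Leg[OF that] \<epsilon>(1)[OF that] by (auto simp: reciprocity_sign_def split: if_splits)
  qed
  have "coprime g (d * nat \<bar>\<Prod>S\<bar>)"
  proof (rule ccontr)
    assume "\<not> coprime g (d * nat \<bar>\<Prod>S\<bar>)"
    hence "\<not> coprime (int g) (int (d * nat \<bar>\<Prod>S\<bar>))" by (simp only: coprime_int_iff not_False_eq_True)
    then obtain p where p: "prime p" "p dvd g" "p dvd d * nat \<bar>\<Prod>S\<bar>"
      using A0 d(1) not_coprime_common_prime[of "int g" "int (d * nat \<bar>\<Prod>S\<bar>)"]
      unfolding int_dvd_int_iff by auto
    have "\<not> p dvd d" using gd p by (metis coprime_common_divisor_nat not_prime_1)
    hence "p dvd nat \<bar>\<Prod>S\<bar>" using p by (simp add: prime_dvd_mult_iff)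
    hence "int p dvd \<Prod>S" by (metis abs_ge_zero dvd_abs_iff int_dvd_int_iff nat_0_le)
    hence "p \<in> P" using p \<open>\<not> p dvd d\<close> by (simp add: P_def)
    thus False using pg p by blast
  qed
  moreover have g0: "g \<noteq> 0"
  proof
    assume "g = 0"
    hence "d = 1" using gd by simp
    thus False using d(2) by simp
  qed
  moreover have "Jacobi a (int g) = \<theta> a" if a: "a \<in> S" for a
  proof -
    have oddg: "odd g" using gd \<open>2 dvd d\<close> by (metis coprime_common_divisor odd_one)
    have "Jacobi (int p) (int g) = \<epsilon> p" if "p \<in> P" for p
    proof -
      have "coprime p g" using pg[OF that] primeP[OF that] by (simp add: prime_imp_coprime)
      thus ?thesis using Jacobi_reciprocity[OF primeP[OF that] P2[OF that] g0 oddg] Leg[OF that]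
        by (auto simp: reciprocity_sign_def)
    qed
    hence "(\<Prod>p\<in>P. Jacobi (int p) (int g) ^ e a p) = c a"
      using \<epsilon>(2)[OF a] by simp
    moreover have "Jacobi (u a) (int g) = Jacobi (u a) (int f)"
      using Jacobi_cong_mod[OF u0[OF a] u_primes[OF a] gd g0 f(1) g(1)] by blast
    moreover have "Jacobi a (int g) = Jacobi (u a) (int g) * (\<Prod>p\<in>P. Jacobi (int p) (int g) ^ e a p)"
      by (subst (1) ue(1)[OF a]) (simp add: Jacobi_mult Jacobi_prod Jacobi_power g0 oddg)
    moreover have "Jacobi (u a) (int f) \<in> {-1, 1}" by (rule Jacobi_values[OF f(1) cop[OF a]])
    ultimately show ?thesis by (auto simp: c_def)
  qed
  ultimately show ?thesis using that g(1) by blast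
qed

subsection \<open>Automorphisms of cyclotomic fields\<close>

abbreviation (input) complex_ring :: "complex ring" where
  "complex_ring \<equiv> ring_of_type_algebra"

lemma complex_ring_simps [simp]:
  "carrier complex_ring = UNIV" "\<one>\<^bsub>complex_ring\<^esub> = 1" "\<zero>\<^bsub>complex_ring\<^esub> = 0"
  "x \<otimes>\<^bsub>complex_ring\<^esub> y = x * y" "x \<oplus>\<^bsub>complex_ring\<^esub> y = x + y"
  by (simp_all add: ring_of_type_algebra_def)

lemma complex_ring_a_inv [simp]: "\<ominus>\<^bsub>complex_ring\<^esub> x = - x"
proof -
  interpret cring complex_ring by (rule cring_from_type_algebra)
  show ?thesis by (rule minus_equality) simp_all
qed

lemma complex_ring_m_inv [simp]: "x \<noteq> 0 \<Longrightarrow> inv\<^bsub>complex_ring\<^esub> x = inverse x"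
proof -
  interpret cring complex_ring by (rule cring_from_type_algebra)
  show "x \<noteq> 0 \<Longrightarrow> inv\<^bsub>complex_ring\<^esub> x = inverse x" by (rule comm_inv_char) simp_all
qed

lemma complex_generate_field_induct [consumes 1, case_names one incl uminus inverse add mult]:
  assumes "x \<in> generate_field complex_ring H"
    and "Q 1" "\<And>h. h \<in> H \<Longrightarrow> Q h"
    and "\<And>h. h \<in> generate_field complex_ring H \<Longrightarrow> Q h \<Longrightarrow> Q (- h)"
    and "\<And>h. h \<in> generate_field complex_ring H \<Longrightarrow> h \<noteq> 0 \<Longrightarrow> Q h \<Longrightarrow> Q (inverse h)"
    and "\<And>h k. h \<in> generate_field complex_ring H \<Longrightarrow> k \<in> generate_field complex_ring H \<Longrightarrow> Q h \<Longrightarrow> Q k \<Longrightarrow> Q (h + k)"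
    and "\<And>h k. h \<in> generate_field complex_ring H \<Longrightarrow> k \<in> generate_field complex_ring H \<Longrightarrow> Q h \<Longrightarrow> Q k \<Longrightarrow> Q (h * k)"
  shows "Q x"
  using assms(1)
proof (induction rule: generate_field.induct)
  case one thus ?case using assms(2) by simp
next
  case (incl h) thus ?case using assms(3) by simp
next
  case (a_inv h) thus ?case using assms(4) by simp
next
  case (m_inv h) thus ?case using assms(5) by simp
next
  case (eng_add h k) thus ?case using assms(6) by simp
next
  case (eng_mult h k) thus ?case using assms(7) by simp
qed

lemma
  fixes H :: "complex set"
  shows complex_generate_field_one: "1 \<in> generate_field complex_ring H"
    and complex_generate_field_incl: "x \<in> H \<Longrightarrow> x \<in> generate_field complex_ring H"
    and complex_generate_field_uminus:
      "x \<in> generate_field complex_ring H \<Longrightarrow> - x \<in> generate_field complex_ring H"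
    and complex_generate_field_inverse:
      "x \<in> generate_field complex_ring H \<Longrightarrow> x \<noteq> 0 \<Longrightarrow> inverse x \<in> generate_field complex_ring H"
    and complex_generate_field_add: "x \<in> generate_field complex_ring H \<Longrightarrow>
      y \<in> generate_field complex_ring H \<Longrightarrow> x + y \<in> generate_field complex_ring H"
    and complex_generate_field_mult: "x \<in> generate_field complex_ring H \<Longrightarrow>
      y \<in> generate_field complex_ring H \<Longrightarrow> x * y \<in> generate_field complex_ring H"
  using generate_field.one[of complex_ring H] generate_field.incl[of x H complex_ring]
    generate_field.a_inv[of x complex_ring H] generate_field.m_inv[of x complex_ring H]
    generate_field.eng_add[of x complex_ring H y] generate_field.eng_mult[of x complex_ring H y]
  by simp_all

lemmas complex_generate_field_intros =
  complex_generate_field_one complex_generate_field_incl complex_generate_field_uminus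
  complex_generate_field_inverse complex_generate_field_add complex_generate_field_mult

lemma complex_generate_field_power:
  "x \<in> generate_field complex_ring H \<Longrightarrow> x ^ n \<in> generate_field complex_ring H"
  by (induction n) (auto intro: complex_generate_field_intros)

lemma coprime_if_cong_mult_1:
  fixes g h N :: nat
  assumes "[g * h = 1] (mod N)"
  shows "coprime h N"
proof -
  have "[h * g = Suc 0] (mod N)" using assms by (simp add: mult.commute)
  thus ?thesis using coprime_iff_invertible_nat by blast
qed

section \<open>The field \<open>\<rat>(w)\<close> and its automorphisms
  \<open>w \<mapsto> w ^ g\<close>\<close>

context root_of_unity
begin

definition frac_field :: "complex set" where
  "frac_field = {x. \<exists>P Q. ev Q w \<noteq> 0 \<and> x = ev P w / ev Q w}"

text \<open>The automorphism \<open>w \<mapsto> w\<^sup>g\<close> of \<open>\<rat>(w)\<close>; the description is unique only for \<open>x \<in> \<rat>(w)\<close> and \<open>g\<close>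
  coprime to \<open>N\<close>, and \<open>w\<close> need not be a primitive root.\<close>

definition pow_aut :: "nat \<Rightarrow> complex \<Rightarrow> complex" where
  "pow_aut g x = (THE y. \<exists>P Q. ev Q w \<noteq> 0 \<and> x = ev P w / ev Q w \<and> y = ev P (w ^ g) / ev Q (w ^ g))"

text \<open>With \<open>g * h \<equiv> 1\<close> modulo \<open>N\<close>, \<open>w\<close> is the
  \<open>h\<close>-th power of \<open>w ^ g\<close>. So \<open>root_pow_coprime\<close> at the base
  \<open>w ^ g\<close> carries a zero there back to \<open>w\<close>.\<close>

lemma ev_pow_nonzero:
  assumes "coprime g N" "ev Q w \<noteq> 0"
  shows "ev Q (w ^ g) \<noteq> 0"
proof
  assume 0: "ev Q (w ^ g) = 0"
  have "(w ^ g) ^ N = (w ^ N) ^ g" unfolding power_mult[symmetric] by (subst mult.commute) (rule refl)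
  then interpret g: root_of_unity "w ^ g" N
    using N_pos root by unfold_locales simp_all
  obtain h where h: "[g * h = 1] (mod N)" using cong_solve_coprime_nat[OF assms(1)] by auto
  hence "coprime h N" by (rule coprime_if_cong_mult_1)
  hence "ev Q ((w ^ g) ^ h) = 0" by (rule g.root_pow_coprime[OF 0])
  thus False using assms(2) power_cong[OF h] by (simp add: power_mult)
qed

text \<open>Well-definedness: cross-multiplying two representations gives an integral polynomial
  that vanishes at \<open>w\<close>, hence at \<open>w ^ g\<close>.\<close>

lemma pow_aut_eq:
  assumes "coprime g N" "ev Q w \<noteq> 0"
  shows "pow_aut g (ev P w / ev Q w) = ev P (w ^ g) / ev Q (w ^ g)"
  unfolding pow_aut_def
proof (rule the_equality)
  fix y assume "\<exists>P' Q'. ev Q' w \<noteq> 0 \<and> ev P w / ev Q w = ev P' w / ev Q' w \<and> y = ev P' (w ^ g) / ev Q' (w ^ g)"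
  then obtain P' Q' where PQ: "ev Q' w \<noteq> 0" "ev P w / ev Q w = ev P' w / ev Q' w" "y = ev P' (w ^ g) / ev Q' (w ^ g)"
    by blast
  have "ev (P * Q' - P' * Q) w = 0" using PQ(1,2) assms(2) by (simp add: field_simps)
  hence "ev (P * Q' - P' * Q) (w ^ g) = 0" by (rule root_pow_coprime[OF _ assms(1)])
  moreover have "ev Q (w ^ g) \<noteq> 0" "ev Q' (w ^ g) \<noteq> 0"
    using ev_pow_nonzero assms PQ(1) by auto
  ultimately show "y = ev P (w ^ g) / ev Q (w ^ g)" unfolding PQ(3) by (simp add: field_simps)
qed (use assms in blast)

lemma pow_aut_ev: "coprime g N \<Longrightarrow> pow_aut g (ev P w) = ev P (w ^ g)"
  using pow_aut_eq[of g 1 P] by simp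

lemma frac_fieldI: "ev Q w \<noteq> 0 \<Longrightarrow> ev P w / ev Q w \<in> frac_field"
  unfolding frac_field_def by blast

lemma frac_fieldE:
  assumes "x \<in> frac_field"
  obtains P Q where "ev Q w \<noteq> 0" "x = ev P w / ev Q w"
  using assms unfolding frac_field_def by blast

lemma ev_in_frac_field: "ev P w \<in> frac_field"
  using frac_fieldI[of 1 P] by simp

context
  fixes g :: nat assumes g: "coprime g N"
begin

lemma pow_aut_add:
  assumes "x \<in> frac_field" "y \<in> frac_field"
  shows "x + y \<in> frac_field" "pow_aut g (x + y) = pow_aut g x + pow_aut g y"
proof -
  obtain P Q where x: "ev Q w \<noteq> 0" "x = ev P w / ev Q w" using assms(1) by (rule frac_fieldE)
  obtain P' Q' where y: "ev Q' w \<noteq> 0" "y = ev P' w / ev Q' w" using assms(2) by (rule frac_fieldE)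
  have eq: "x + y = ev (P * Q' + P' * Q) w / ev (Q * Q') w" and nz: "ev (Q * Q') w \<noteq> 0"
    unfolding x(2) y(2) using x(1) y(1) by (simp_all add: add_frac_eq)
  show "x + y \<in> frac_field" unfolding eq by (rule frac_fieldI[OF nz])
  show "pow_aut g (x + y) = pow_aut g x + pow_aut g y"
    unfolding eq pow_aut_eq[OF g nz] unfolding x(2) y(2) pow_aut_eq[OF g x(1)] pow_aut_eq[OF g y(1)]
    using ev_pow_nonzero[OF g x(1)] ev_pow_nonzero[OF g y(1)] by (simp add: add_frac_eq)
qed

lemma pow_aut_mult:
  assumes "x \<in> frac_field" "y \<in> frac_field"
  shows "x * y \<in> frac_field" "pow_aut g (x * y) = pow_aut g x * pow_aut g y"
proof -
  obtain P Q where x: "ev Q w \<noteq> 0" "x = ev P w / ev Q w" using assms(1) by (rule frac_fieldE)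
  obtain P' Q' where y: "ev Q' w \<noteq> 0" "y = ev P' w / ev Q' w" using assms(2) by (rule frac_fieldE)
  have eq: "x * y = ev (P * P') w / ev (Q * Q') w" and nz: "ev (Q * Q') w \<noteq> 0"
    using x y by simp_all
  show "x * y \<in> frac_field" unfolding eq by (rule frac_fieldI[OF nz])
  show "pow_aut g (x * y) = pow_aut g x * pow_aut g y"
    unfolding eq pow_aut_eq[OF g nz] unfolding x(2) y(2) pow_aut_eq[OF g x(1)] pow_aut_eq[OF g y(1)]
    by simp
qed

lemma pow_aut_inverse:
  assumes "x \<in> frac_field" "x \<noteq> 0"
  shows "inverse x \<in> frac_field" "pow_aut g (inverse x) = inverse (pow_aut g x)"
proof -
  obtain P Q where x: "ev Q w \<noteq> 0" "x = ev P w / ev Q w" using assms(1) by (rule frac_fieldE)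
  have eq: "inverse x = ev Q w / ev P w" and nz: "ev P w \<noteq> 0" using x assms(2) by auto
  show "inverse x \<in> frac_field" unfolding eq by (rule frac_fieldI[OF nz])
  show "pow_aut g (inverse x) = inverse (pow_aut g x)"
    unfolding eq pow_aut_eq[OF g nz] unfolding x(2) pow_aut_eq[OF g x(1)] by simp
qed

lemma pow_aut_uminus:
  assumes "x \<in> frac_field"
  shows "- x \<in> frac_field" "pow_aut g (- x) = - pow_aut g x"
  using pow_aut_mult[OF ev_in_frac_field[of "-1"] assms] pow_aut_ev[OF g, of "-1"] by simp_all

lemma pow_aut_rat:
  assumes "x \<in> \<rat>"
  shows "x \<in> frac_field" "pow_aut g x = x"
proof -
  obtain a b where x: "x = of_int a / of_int b" "b \<noteq> 0" using assms by (elim Rats_cases') auto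
  have eq: "x = ev [:a:] w / ev [:b:] w" and nz: "ev [:b:] w \<noteq> 0" using x by auto
  show "x \<in> frac_field" unfolding eq by (rule frac_fieldI[OF nz])
  show "pow_aut g x = x" unfolding eq pow_aut_eq[OF g nz] by simp
qed

lemma pow_aut_inverse_left:
  assumes "[g * h = 1] (mod N)" "x \<in> frac_field"
  shows "pow_aut h (pow_aut g x) = x"
proof -
  have h: "coprime h N" using assms(1) by (rule coprime_if_cong_mult_1)
  obtain P Q where x: "ev Q w \<noteq> 0" "x = ev P w / ev Q w" using assms(2) by (rule frac_fieldE)
  have nz: "ev (Q \<circ>\<^sub>p monom 1 g) w \<noteq> 0" using ev_pow_nonzero[OF g x(1)] by simp
  have "pow_aut g x = ev (P \<circ>\<^sub>p monom 1 g) w / ev (Q \<circ>\<^sub>p monom 1 g) w"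
    unfolding x(2) pow_aut_eq[OF g x(1)] by simp
  also have "pow_aut h \<dots> = ev P ((w ^ h) ^ g) / ev Q ((w ^ h) ^ g)"
    unfolding pow_aut_eq[OF h nz] by simp
  also have "(w ^ h) ^ g = w"
    using power_cong[OF assms(1)] unfolding power_mult[symmetric] by (simp add: mult.commute)
  finally show ?thesis by (simp add: x)
qed

text \<open>Reduces stability of the generated field under the automorphism to a check on
  generators, which will be applied to \<open>K\<close>.\<close>

lemma generate_field_pow_aut:
  assumes "\<And>h. h \<in> H \<Longrightarrow> h \<in> frac_field \<and> pow_aut g h \<in> generate_field complex_ring H"
    and "x \<in> generate_field complex_ring H"
  shows "x \<in> frac_field" "pow_aut g x \<in> generate_field complex_ring H"
proof -
  have "x \<in> frac_field \<and> pow_aut g x \<in> generate_field complex_ring H"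
    using assms(2)
  proof (induction rule: complex_generate_field_induct)
    case one
    show ?case using pow_aut_rat[of 1] by (simp add: complex_generate_field_one)
  next
    case (inverse h)
    hence "pow_aut g (h * inverse h) = pow_aut g h * pow_aut g (inverse h)"
      by (intro pow_aut_mult(2) pow_aut_inverse(1)) auto
    hence "pow_aut g h \<noteq> 0" using pow_aut_rat(2)[of 1] inverse by auto
    thus ?case using inverse by (simp add: pow_aut_inverse complex_generate_field_inverse)
  next
    case (incl h)
    thus ?case by (rule assms(1))
  next
    case (uminus h)
    thus ?case by (simp add: pow_aut_uminus complex_generate_field_uminus)
  next
    case (add h k)
    thus ?case by (simp add: pow_aut_add complex_generate_field_add)
  next
    case (mult h k)
    thus ?case by (simp add: pow_aut_mult complex_generate_field_mult)
  qed
  thus "x \<in> frac_field" "pow_aut g x \<in> generate_field complex_ring H" by auto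
qed

end

end

lemma primitive_root_exists:
  assumes "N > 0"
  obtains w where "primitive_root_of_unity N w"
proof
  define w where "w = cis (2 * pi / N)"
  have pw: "w ^ k = cis (2 * pi * k / N)" for k
    unfolding w_def DeMoivre by (simp add: field_simps)
  note bij = bij_betw_roots_unity[OF assms]
  show "primitive_root_of_unity N w" unfolding primitive_root_of_unity_def
  proof (intro conjI allI impI)
    show "w ^ N = 1" using assms unfolding pw by simp
    fix k assume k: "0 < k \<and> k < N"
    show "w ^ k \<noteq> 1"
    proof
      assume "w ^ k = 1"
      hence "cis (2 * pi * real k / N) = cis (2 * pi * real 0 / N)" unfolding pw by simp
      hence "k = 0" using inj_onD[OF bij_betw_imp_inj_on[OF bij], of k 0] k assms by simp
      thus False using k by simp
    qed
  qed
qed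

subsection \<open>The Galois group\<close>

lemma group_unit_group_mod: "d \<ge> 2 \<Longrightarrow> group (unit_group_mod d)"
proof -
  assume "d \<ge> 2"
  then interpret residues "int d" "residue_ring (int d)" by unfold_locales auto
  show ?thesis unfolding unit_group_mod_def by (rule units_group)
qed

lemma unit_group_mod_mult: "x \<otimes>\<^bsub>unit_group_mod d\<^esub> y = (x * y) mod int d"
  by (simp add: unit_group_mod_def units_of_mult residue_ring_def)

lemma group_sign_maps: "group (sign_maps S)"
  unfolding sign_maps_def by (intro product_group int.units_group)

lemma sign_maps_mult: "x \<otimes>\<^bsub>sign_maps S\<^esub> y = (\<lambda>a\<in>S. x a * y a)"
  by (simp add: sign_maps_def units_of_mult)

lemma D0_group_alt: "D0_group S d = (unit_group_mod d \<times>\<times> sign_maps S)\<lparr>carrier := carrier (D0_group S d)\<rparr>"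
  by (simp add: D0_group_def)

locale sqrt_cyclotomic =
  fixes S :: "int set" and d :: nat and \<zeta> :: complex
  assumes S: "finite S" "0 \<notin> S" and d: "d \<ge> 3" "8 dvd d" and prim: "primitive_root_of_unity d \<zeta>"
begin

sublocale zeta: primitive_root8 \<zeta> d
  using d prim by unfold_locales auto

definition rt :: "int \<Rightarrow> complex" where "rt a = csqrt (of_int a)"

lemma rt_sq [simp]: "rt a ^ 2 = of_int a"
  by (simp add: rt_def)

lemma rt_nonzero: "a \<in> S \<Longrightarrow> rt a \<noteq> 0"
  using S by (auto simp: rt_def)

definition gens :: "complex set" where "gens = \<rat> \<union> rt ` S \<union> {\<zeta>}"

definition K :: "complex set" where "K = generate_field complex_ring gens"

abbreviation L :: "complex ring" where "L \<equiv> sqrt_cyclotomic_field S \<zeta>"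
abbreviation Gal :: "(complex \<Rightarrow> complex) monoid" where "Gal \<equiv> galois_group L \<rat>"

lemma L_simps [simp]:
  "carrier L = K" "x \<otimes>\<^bsub>L\<^esub> y = x * y" "x \<oplus>\<^bsub>L\<^esub> y = x + y" "\<one>\<^bsub>L\<^esub> = 1"
  by (simp_all add: sqrt_cyclotomic_field_def K_def gens_def rt_def[abs_def])

lemma K_incl: "x \<in> gens \<Longrightarrow> x \<in> K"
  unfolding K_def by (rule complex_generate_field_incl)

lemma K_one [simp]: "1 \<in> K"
  and K_rat [simp]: "x \<in> \<rat> \<Longrightarrow> x \<in> K"
  and K_zeta [simp]: "\<zeta> \<in> K"
  and K_rt [simp]: "a \<in> S \<Longrightarrow> rt a \<in> K"
  and K_uminus [simp]: "x \<in> K \<Longrightarrow> - x \<in> K"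
  and K_inverse [simp]: "x \<in> K \<Longrightarrow> x \<noteq> 0 \<Longrightarrow> inverse x \<in> K"
  and K_add [simp]: "x \<in> K \<Longrightarrow> y \<in> K \<Longrightarrow> x + y \<in> K"
  and K_mult [simp]: "x \<in> K \<Longrightarrow> y \<in> K \<Longrightarrow> x * y \<in> K"
  and K_power [simp]: "x \<in> K \<Longrightarrow> x ^ n \<in> K"
  by ((rule K_incl, simp add: gens_def; fail) | (simp add: K_def complex_generate_field_one
      complex_generate_field_uminus complex_generate_field_inverse complex_generate_field_add
      complex_generate_field_mult complex_generate_field_power; fail))+

text \<open>In plain complex arithmetic: preservation of 1 comes from fixing \<open>\<rat>\<close>,
  and closure of \<open>K\<close> from \<open>Bij K\<close>.\<close>

lemma galois_iff:
  "\<sigma> \<in> carrier Gal \<longleftrightarrow> \<sigma> \<in> Bij K \<and> (\<forall>x\<in>K. \<forall>y\<in>K. \<sigma> (x + y) = \<sigma> x + \<sigma> y) \<and>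
     (\<forall>x\<in>K. \<forall>y\<in>K. \<sigma> (x * y) = \<sigma> x * \<sigma> y) \<and> (\<forall>x\<in>\<rat>. \<sigma> x = x)"
proof -
  have "\<sigma> \<in> Bij K \<Longrightarrow> \<sigma> \<in> K \<rightarrow> K \<and> bij_betw \<sigma> K K" using Bij_imp_funcset by (auto simp: Bij_def)
  moreover have "\<forall>x\<in>\<rat>. \<sigma> x = x \<Longrightarrow> \<sigma> 1 = 1" by simp
  ultimately show ?thesis
    unfolding galois_group_def ring_iso_def ring_hom_def by (auto simp: Pi_iff)
qed

lemma galois_mult: "\<sigma> \<in> carrier Gal \<Longrightarrow> \<tau> \<in> carrier Gal \<Longrightarrow> \<sigma> \<otimes>\<^bsub>Gal\<^esub> \<tau> = compose K \<sigma> \<tau>"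
  using galois_iff by (simp add: galois_group_def BijGroup_def)

lemma galois_closed: "\<sigma> \<in> carrier Gal \<Longrightarrow> x \<in> K \<Longrightarrow> \<sigma> x \<in> K"
  using galois_iff Bij_imp_funcset by (metis PiE)

lemma group_galois: "group Gal"
proof -
  interpret B: group "BijGroup K" by (rule group_BijGroup)
  have "subgroup (carrier Gal) (BijGroup K)"
  proof (rule B.subgroupI)
    show "carrier Gal \<subseteq> carrier (BijGroup K)" using galois_iff by (auto simp: BijGroup_def)
    have "(\<lambda>x\<in>K. x) \<in> carrier Gal" unfolding galois_iff by (simp add: id_Bij)
    thus "carrier Gal \<noteq> {}" by blast
  next
    fix \<sigma> assume \<sigma>: "\<sigma> \<in> carrier Gal"
    hence B: "\<sigma> \<in> Bij K" and bij: "bij_betw \<sigma> K K" by (auto simp: galois_iff Bij_def)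
    have inv: "inv_into K \<sigma> x \<in> K \<and> \<sigma> (inv_into K \<sigma> x) = x" if "x \<in> K" for x
      using bij that by (metis bij_betw_def f_inv_into_f inv_into_into)
    have eq: "inv_into K \<sigma> x = y" if "y \<in> K" "\<sigma> y = x" for x y
      using bij that by (auto simp: bij_betw_def)
    have "(\<lambda>x\<in>K. inv_into K \<sigma> x) \<in> carrier Gal" unfolding galois_iff
    proof (intro conjI ballI restrict_inv_into_Bij[OF B])
      fix x y assume x: "x \<in> K" "y \<in> K"
      have "inv_into K \<sigma> (x + y) = inv_into K \<sigma> x + inv_into K \<sigma> y"
        using inv[OF x(1)] inv[OF x(2)] \<sigma> by (intro eq) (auto simp: galois_iff)
      thus "restrict (inv_into K \<sigma>) K (x + y) = restrict (inv_into K \<sigma>) K x + restrict (inv_into K \<sigma>) K y"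
        using x by simp
      have "inv_into K \<sigma> (x * y) = inv_into K \<sigma> x * inv_into K \<sigma> y"
        using inv[OF x(1)] inv[OF x(2)] \<sigma> by (intro eq) (auto simp: galois_iff)
      thus "restrict (inv_into K \<sigma>) K (x * y) = restrict (inv_into K \<sigma>) K x * restrict (inv_into K \<sigma>) K y"
        using x by simp
    next
      fix x :: complex assume x: "x \<in> \<rat>"
      have "inv_into K \<sigma> x = x" using \<sigma> x by (intro eq) (auto simp: galois_iff)
      thus "restrict (inv_into K \<sigma>) K x = x" using x by simp
    qed
    thus "inv\<^bsub>BijGroup K\<^esub> \<sigma> \<in> carrier Gal" by (simp add: inv_BijGroup[OF B])
  next
    fix \<sigma> \<tau> assume \<sigma>: "\<sigma> \<in> carrier Gal" "\<tau> \<in> carrier Gal"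
    have "compose K \<sigma> \<tau> \<in> carrier Gal" unfolding galois_iff
      using \<sigma> galois_closed[OF \<sigma>(2)] by (auto simp: galois_iff compose_Bij compose_eq)
    thus "\<sigma> \<otimes>\<^bsub>BijGroup K\<^esub> \<tau> \<in> carrier Gal" using \<sigma> by (simp add: BijGroup_def galois_iff)
  qed
  hence "group (BijGroup K\<lparr>carrier := carrier Gal\<rparr>)" by (rule B.subgroup_imp_group)
  thus ?thesis by (simp add: galois_group_def)
qed

text \<open>An automorphism is determined by its values on generators of \<open>K\<close>. This will
  give injectivity of \<open>\<Psi>\<close>.\<close>

lemma galois_eqI:
  assumes "\<sigma> \<in> carrier Gal" "\<tau> \<in> carrier Gal" "\<sigma> \<zeta> = \<tau> \<zeta>" "\<And>a. a \<in> S \<Longrightarrow> \<sigma> (rt a) = \<tau> (rt a)"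
  shows "\<sigma> = \<tau>"
proof -
  have eq: "\<sigma> x = \<tau> x" if "x \<in> generate_field complex_ring gens" for x
    using that
  proof (induction rule: complex_generate_field_induct)
    case one
    have "(1::complex) \<in> \<rat>" by simp
    thus ?case using assms(1,2) unfolding galois_iff by metis
  next
    case (incl h)
    thus ?case using assms unfolding galois_iff gens_def by auto
  next
    case (uminus h)
    have *: "\<rho> (- h) = - \<rho> h" if \<rho>: "\<rho> \<in> carrier Gal" for \<rho>
    proof -
      have h: "h \<in> K" using uminus(1) by (simp add: K_def)
      have "\<rho> ((-1) * h) = \<rho> (-1) * \<rho> h" using \<rho> h unfolding galois_iff by (metis K_one K_uminus)
      moreover have "\<rho> (-1) = -1" using \<rho> unfolding galois_iff by simp
      ultimately show ?thesis by simp
    qed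
    show ?case unfolding *[OF assms(1)] *[OF assms(2)] uminus(2) ..
  next
    case (inverse h)
    have h: "h \<in> K" "inverse h \<in> K" using inverse(1,2) by (auto simp: K_def complex_generate_field_inverse)
    have *: "\<rho> h * \<rho> (inverse h) = 1" if "\<rho> \<in> carrier Gal" for \<rho>
    proof -
      have "\<rho> h * \<rho> (inverse h) = \<rho> (h * inverse h)" using that h by (simp add: galois_iff)
      also have "\<dots> = \<rho> 1" using inverse(2) by simp
      finally show ?thesis using that by (simp add: galois_iff)
    qed
    have "\<tau> h \<noteq> 0" using *[OF assms(2)] by auto
    moreover have "\<tau> h * \<sigma> (inverse h) = \<tau> h * \<tau> (inverse h)"
      using *[OF assms(1)] *[OF assms(2)] inverse(3) by simp
    ultimately show ?case by simp
  qed (use assms(1,2) in \<open>auto simp: galois_iff K_def\<close>)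
  show ?thesis
  proof
    fix x
    show "\<sigma> x = \<tau> x"
    proof (cases "x \<in> K")
      case True
      thus ?thesis using eq by (simp add: K_def)
    next
      case False
      \<comment> \<open>Outside \<open>K\<close> both maps are \<open>undefined\<close>, by
        extensionality.\<close>
      thus ?thesis using assms(1,2) unfolding galois_iff Bij_def by (metis IntD1 extensional_arb)
    qed
  qed
qed

lemma galois_ev:
  assumes "\<sigma> \<in> carrier Gal" "x \<in> K"
  shows "ev P x \<in> K" "\<sigma> (ev P x) = ev P (\<sigma> x)"
proof -
  have "ev P x \<in> K \<and> \<sigma> (ev P x) = ev P (\<sigma> x)"
    using assms by (induction P) (auto simp: galois_iff)
  thus "ev P x \<in> K" "\<sigma> (ev P x) = ev P (\<sigma> x)" by auto
qed

lemma galois_power: "\<sigma> \<in> carrier Gal \<Longrightarrow> x \<in> K \<Longrightarrow> \<sigma> (x ^ n) = \<sigma> x ^ n"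
  using galois_ev(2)[of \<sigma> x "monom 1 n"] by simp

section \<open>Automorphisms of \<open>K\<close> and the pairs describing them\<close>

lemma carrier_pairs:
  "p \<in> carrier (unit_group_mod d \<times>\<times> sign_maps S) \<longleftrightarrow>
     1 \<le> fst p \<and> fst p < int d \<and> coprime (fst p) (int d) \<and> snd p \<in> S \<rightarrow>\<^sub>E {-1, 1}"
  using d carrier_unit_group_mod[of d] carrier_sign_maps[of S] by (cases p) (auto simp: DirProd_def)

text \<open>A relation rather than a map, so that existence and uniqueness can be proved separately
  in both directions. The range conditions on \<open>p\<close> make the pair unique.\<close>

definition acts :: "(complex \<Rightarrow> complex) \<Rightarrow> int \<times> (int \<Rightarrow> int) \<Rightarrow> bool" where
  "acts \<sigma> p \<longleftrightarrow> 1 \<le> fst p \<and> fst p < int d \<and> coprime (fst p) (int d) \<and> snd p \<in> S \<rightarrow>\<^sub>E {-1, 1} \<and>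
     \<sigma> \<zeta> = \<zeta> ^ nat (fst p) \<and> (\<forall>a\<in>S. \<sigma> (rt a) = of_int (snd p a) * rt a)"

lemma acts_carrier: "acts \<sigma> p \<Longrightarrow> p \<in> carrier (unit_group_mod d \<times>\<times> sign_maps S)"
  unfolding acts_def carrier_pairs by blast

lemma acts_unique:
  assumes "acts \<sigma> p" "acts \<sigma> q"
  shows "p = q"
proof (rule prod_eqI)
  have "nat (fst p) = nat (fst q)"
    using assms d by (intro primitive_root_inj[OF prim]) (auto simp: acts_def)
  thus "fst p = fst q" using assms by (auto simp: acts_def)
  show "snd p = snd q"
  proof (rule extensionalityI)
    show "snd p \<in> extensional S" "snd q \<in> extensional S"
      using assms by (auto simp: acts_def PiE_def)
    show "snd p a = snd q a" if "a \<in> S" for a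
      using assms that rt_nonzero[OF that] by (auto simp: acts_def)
  qed
qed

text \<open>The image of \<open>\<zeta>\<close> is a \<open>d\<close>-th root of unity, hence a
  power of \<open>\<zeta>\<close>, and injectivity makes its exponent coprime to \<open>d\<close>.
  The image of \<open>rt a\<close> is again a square root of \<open>a\<close>.\<close>

lemma acts_exists:
  assumes "\<sigma> \<in> carrier Gal"
  shows "\<exists>p. acts \<sigma> p"
proof -
  have inj: "inj_on \<sigma> K" using assms by (auto simp: galois_iff Bij_def bij_betw_def)
  have one: "\<sigma> 1 = 1" using assms by (simp add: galois_iff)
  have "\<sigma> \<zeta> ^ d = 1" using galois_power[OF assms K_zeta, of d] one zeta.root by simp
  then obtain j where j: "j < d" "\<sigma> \<zeta> = \<zeta> ^ j" using primitive_root_surj[OF prim] d by auto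
  have "coprime j d"
  proof (rule ccontr)
    assume nc: "\<not> coprime j d"
    \<comment> \<open>A common factor \<open>e > 1\<close> would give
      \<open>\<sigma> (\<zeta> ^ (d div e)) = 1 = \<sigma> 1\<close>, against primitivity.\<close>
    define e where "e = gcd j d"
    have "e \<noteq> 1" using nc unfolding e_def coprime_iff_gcd_eq_1 .
    moreover have "e \<noteq> 0" using d unfolding e_def by simp
    ultimately have "e > 1" by linarith
    hence e: "e dvd j" "e dvd d" "e > 1" unfolding e_def by auto
    then obtain j' d' where jd: "j = e * j'" "d = e * d'" by (metis dvdE)
    have d': "0 < d'" using jd d by (cases "d' = 0") auto
    hence "d' < d" using e(3) n_less_m_mult_n[of d' e] unfolding jd(2) by simp
    note d' = d' this
    have "\<sigma> (\<zeta> ^ d') = \<zeta> ^ (j * d')" using galois_power[OF assms K_zeta] j by (simp add: power_mult)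
    also have "j * d' = d * j'" by (simp add: jd)
    also have "\<zeta> ^ (d * j') = \<sigma> 1" using one zeta.root by (simp add: power_mult)
    finally have "\<zeta> ^ d' = 1" using inj by (auto dest: inj_onD)
    thus False using prim d' by (auto simp: primitive_root_of_unity_def)
  qed
  moreover from this have "j \<noteq> 0" using d by (cases "j = 0") auto
  ultimately have f: "1 \<le> int j" "int j < int d" "coprime (int j) (int d)" using j by auto
  define \<theta> where "\<theta> = (\<lambda>a\<in>S. if \<sigma> (rt a) = rt a then 1 else -1 :: int)"
  have "\<sigma> (rt a) = of_int (\<theta> a) * rt a" if "a \<in> S" for a
  proof -
    have "\<sigma> (rt a) ^ 2 = \<sigma> (of_int a)" using galois_power[OF assms K_rt[OF that], of 2] by simp
    also have "\<dots> = rt a ^ 2" using assms by (simp add: galois_iff)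
    finally show ?thesis using that unfolding power2_eq_iff by (auto simp: \<theta>_def)
  qed
  hence "acts \<sigma> (int j, \<theta>)" using f j by (auto simp: acts_def \<theta>_def)
  thus ?thesis by blast
qed

lemma acts_mult:
  assumes "\<sigma> \<in> carrier Gal" "\<tau> \<in> carrier Gal" "acts \<sigma> p" "acts \<tau> q"
  shows "acts (\<sigma> \<otimes>\<^bsub>Gal\<^esub> \<tau>) (p \<otimes>\<^bsub>unit_group_mod d \<times>\<times> sign_maps S\<^esub> q)"
proof -
  interpret G: group "unit_group_mod d \<times>\<times> sign_maps S"
    using d by (intro DirProd_group group_unit_group_mod group_sign_maps) auto
  let ?r = "p \<otimes>\<^bsub>unit_group_mod d \<times>\<times> sign_maps S\<^esub> q"
  have r: "fst ?r = (fst p * fst q) mod int d" "snd ?r = (\<lambda>a\<in>S. snd p a * snd q a)"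
    by (simp_all add: mult_DirProd' unit_group_mod_mult sign_maps_mult)
  have "?r \<in> carrier (unit_group_mod d \<times>\<times> sign_maps S)"
    using assms(3,4)[THEN acts_carrier] by (rule G.m_closed)
  moreover have "compose K \<sigma> \<tau> \<zeta> = \<zeta> ^ nat (fst ?r)"
  proof -
    have "compose K \<sigma> \<tau> \<zeta> = \<zeta> ^ (nat (fst p) * nat (fst q))"
      using assms galois_power[OF assms(1) K_zeta] by (simp add: acts_def compose_eq power_mult)
    also have "\<dots> = \<zeta> ^ nat (fst ?r)"
    proof (rule zeta.power_cong)
      have "fst p \<ge> 0" "fst q \<ge> 0" using assms(3,4) by (auto simp: acts_def)
      hence "nat (fst ?r) = (nat (fst p) * nat (fst q)) mod d"
        by (simp add: r nat_mod_distrib nat_mult_distrib)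
      thus "[nat (fst p) * nat (fst q) = nat (fst ?r)] (mod d)" by (simp add: cong_def)
    qed
    finally show ?thesis .
  qed
  moreover have "compose K \<sigma> \<tau> (rt a) = of_int (snd ?r a) * rt a" if a: "a \<in> S" for a
  proof -
    have "\<sigma> (of_int (snd q a) * rt a) = \<sigma> (of_int (snd q a)) * \<sigma> (rt a)"
      using assms(1) a by (simp add: galois_iff)
    also have "\<sigma> (of_int (snd q a)) = of_int (snd q a)" using assms(1) by (simp add: galois_iff)
    finally show ?thesis using assms(3,4) a unfolding r by (simp add: acts_def compose_eq)
  qed
  ultimately show ?thesis unfolding acts_def carrier_pairs galois_mult[OF assms(1,2)] by blast
qed

text \<open>The action of \<open>\<sigma>\<close> on the product of \<open>rt a\<close> over
  \<open>T\<close> is computed twice: factor by factor it gives the sign \<open>\<theta>(T)\<close>;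
  as an integer multiple of a square root of \<open>sqf T\<close> in \<open>\<int>[\<zeta>]\<close>,
  the product is multiplied by the Jacobi symbol.\<close>

lemma acts_imp_D0:
  assumes \<sigma>: "\<sigma> \<in> carrier Gal" and p: "acts \<sigma> p"
  shows "p \<in> carrier (D0_group S d)"
proof -
  obtain f \<theta> where f\<theta>: "p = (f, \<theta>)" by (cases p)
  have f: "1 \<le> f" "f < int d" "coprime f (int d)" and \<theta>: "\<And>a. a \<in> S \<Longrightarrow> \<theta> a \<in> {-1, 1}"
    and act: "\<sigma> \<zeta> = \<zeta> ^ nat f" "\<And>a. a \<in> S \<Longrightarrow> \<sigma> (rt a) = of_int (\<theta> a) * rt a"
    using p unfolding acts_def f\<theta> by auto
  have "(\<Prod>s\<in>T. \<theta> s) * Jacobi (sqf T) f = 1" if "T \<in> D0_family S d" for T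
  proof -
    have T: "T \<subseteq> S" "sqf T dvd int d" using that by (auto simp: D0_family_def)
    have fT: "finite T" "0 \<notin> T" using T S finite_subset by auto
    obtain k where k: "\<Prod>T = sqf T * k\<^sup>2" "k \<noteq> 0" "squarefree (sqf T)" "sqf T \<noteq> 0"
      using sqf_prod_decomposition[OF fT] by blast
    have primes: "q dvd d" if "prime q" "int q dvd sqf T" for q
      using that T by (metis dvd_trans int_dvd_int_iff)
    obtain P where P: "ev P \<zeta> ^ 2 = of_int (sqf T)"
      using zeta.is_square_if_primes_dvd[OF k(4) primes] unfolding zeta.is_square_def by blast
    have J: "ev P (\<zeta> ^ nat f) = of_int (Jacobi (sqf T) f) * ev P \<zeta>"
      using zeta.sqrt_pow_eq_Jacobi[OF k(4) primes P, of "nat f"] f by (simp add: coprime_int_iff[symmetric])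
    define r where "r = (\<Prod>a\<in>T. rt a)"
    have r: "r \<in> K \<and> \<sigma> r = of_int (\<Prod>a\<in>T. \<theta> a) * r"
      unfolding r_def using fT(1) T(1)
    proof (induction T)
      case empty
      thus ?case using \<sigma> by (simp add: galois_iff)
    next
      case (insert a T)
      have "\<sigma> (rt a * (\<Prod>a\<in>T. rt a)) = \<sigma> (rt a) * \<sigma> (\<Prod>a\<in>T. rt a)"
        using \<sigma> insert by (simp add: galois_iff)
      thus ?case using insert act(2)[of a] by simp
    qed
    have r2: "r ^ 2 = (of_int k * ev P \<zeta>) ^ 2"
    proof -
      have "r ^ 2 = of_int (\<Prod>T)" by (simp add: r_def prod_power_distrib)
      thus ?thesis by (simp add: k(1) P power_mult_distrib)
    qed
    \<comment> \<open>\<open>l\<close> is \<open>k\<close> or \<open>- k\<close>, according to the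
      choice of square root.\<close>
    then obtain l :: int where l: "r = of_int l * ev P \<zeta>" unfolding power2_eq_iff
      by (metis mult_minus_left of_int_minus)
    have r0: "r \<noteq> 0" using fT(1) T(1) rt_nonzero by (auto simp: r_def)
    have "\<sigma> r = \<sigma> (ev (smult l P) \<zeta>)" by (simp add: l)
    also have "\<dots> = of_int l * ev P (\<zeta> ^ nat f)"
      unfolding galois_ev(2)[OF \<sigma> K_zeta] act(1) by simp
    also have "\<dots> = of_int (Jacobi (sqf T) f) * r" unfolding J by (simp add: l)
    finally have "of_int (\<Prod>a\<in>T. \<theta> a) * r = of_int (Jacobi (sqf T) f) * r" using r by simp
    hence "(\<Prod>a\<in>T. \<theta> a) = Jacobi (sqf T) f" using r0 by (simp only: mult_cancel_right of_int_eq_iff simp_thms)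
    \<comment> \<open>The two signs are equal; their product is 1 because a sign squares to
      1.\<close>
    moreover have "\<bar>\<Prod>a\<in>T. \<theta> a\<bar> = 1"
      unfolding abs_prod using T(1) \<theta> by (intro prod.neutral) force
    hence "(\<Prod>a\<in>T. \<theta> a) * (\<Prod>a\<in>T. \<theta> a) = 1" by (metis abs_mult_self mult.right_neutral)
    ultimately show ?thesis by simp
  qed
  thus ?thesis using acts_carrier[OF p] unfolding f\<theta> by (simp add: D0_group_def)
qed

text \<open>Surjectivity of \<open>\<Psi>\<close>: pass to \<open>\<rat>(w)\<close> with
  \<open>w\<close> of order \<open>d * nat \<bar>\<Prod>S\<bar>\<close>, which contains all of
  \<open>K\<close>, and restrict \<open>w \<mapsto> w ^ g\<close> for a suitable
  \<open>g\<close>.\<close>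

lemma D0_imp_acts:
  assumes "p \<in> carrier (D0_group S d)"
  shows "\<exists>\<sigma>\<in>carrier Gal. acts \<sigma> p"
proof -
  obtain f \<theta> where f\<theta>: "p = (f, \<theta>)" by (cases p)
  have p: "p \<in> carrier (unit_group_mod d \<times>\<times> sign_maps S)"
    using assms by (simp add: D0_group_def f\<theta>)
  have D0: "\<And>T. T \<subseteq> S \<Longrightarrow> sqf T dvd int d \<Longrightarrow> (\<Prod>s\<in>T. \<theta> s) * Jacobi (sqf T) f = 1"
    using assms unfolding D0_group_def D0_family_def f\<theta> by auto
  have f: "1 \<le> f" "f < int d" "coprime f (int d)" and \<theta>: "\<And>a. a \<in> S \<Longrightarrow> \<theta> a \<in> {-1, 1}"
    using p unfolding carrier_pairs f\<theta> by auto
  obtain n where n: "f = int n" using f(1) nonneg_int_cases[of f] by auto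
  have natf: "n \<noteq> 0" "coprime n d" using f unfolding n by auto
  define N where "N = d * nat \<bar>\<Prod>S\<bar>"
  have "\<Prod>S \<noteq> 0" using S by auto
  hence N: "N > 0" "8 dvd N" "d dvd N" using d by (auto simp: N_def)
  obtain g where g: "g \<noteq> 0" "coprime g N" "[g = n] (mod d)" "\<And>a. a \<in> S \<Longrightarrow> Jacobi a (int g) = \<theta> a"
  proof (rule exists_unit_with_Jacobi_values[OF S zeta.N_pos d(2) prim natf \<theta> D0[unfolded n], folded N_def])
    fix g assume "g \<noteq> 0" "coprime g N" "[g = n] (mod d)" "\<And>a. a \<in> S \<Longrightarrow> Jacobi a (int g) = \<theta> a"
    thus thesis by (rule that)
  qed
  obtain w where w: "primitive_root_of_unity N w" using primitive_root_exists[OF N(1)] by blast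
  interpret W: primitive_root8 w N using N w by unfold_locales
  have "\<zeta> ^ N = 1" unfolding N_def power_mult zeta.root by simp
  then obtain j where j: "\<zeta> = w ^ j" using primitive_root_surj[OF w N(1)] by blast
  have zeta: "\<zeta> \<in> W.frac_field" "coprime h N \<Longrightarrow> W.pow_aut h \<zeta> = \<zeta> ^ h" for h
  proof -
    have eq: "\<zeta> = ev (monom 1 j) w" by (simp add: j)
    show "\<zeta> \<in> W.frac_field" unfolding eq by (rule W.ev_in_frac_field)
    show "W.pow_aut h \<zeta> = \<zeta> ^ h" if "coprime h N"
      unfolding eq W.pow_aut_ev[OF that] by (simp add: power_mult[symmetric] mult.commute)
  qed
  have root: "rt a \<in> W.frac_field \<and> (coprime h N \<longrightarrow> h \<noteq> 0 \<longrightarrow> W.pow_aut h (rt a) = of_int (Jacobi a (int h)) * rt a)"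
    if a: "a \<in> S" for a h
  proof -
    have a0: "a \<noteq> 0" using S a by auto
    have primes: "q dvd N" if "prime q" "int q dvd a" for q
    proof -
      have "a dvd \<Prod>S" using S a by (intro dvd_prodI) auto
      hence "int q dvd \<Prod>S" using that(2) dvd_trans by blast
      hence "q dvd nat \<bar>\<Prod>S\<bar>" by (metis abs_ge_zero dvd_abs_iff int_dvd_int_iff nat_0_le)
      thus ?thesis by (simp add: N_def)
    qed
    obtain P where P: "ev P w ^ 2 = of_int a"
      using W.is_square_if_primes_dvd[OF a0 primes] unfolding W.is_square_def by blast
    have "rt a ^ 2 = ev P w ^ 2" using P by simp
    hence "rt a = ev (smult 1 P) w \<or> rt a = ev (smult (-1) P) w" unfolding power2_eq_iff by simp
    \<comment> \<open>The factor \<open>c\<close> is 1 or -1 and adjusts \<open>P\<close> to the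
      branch chosen by \<open>csqrt\<close>.\<close>
    then obtain c where c: "rt a = ev (smult c P) w" by blast
    have c2: "ev (smult c P) w ^ 2 = of_int a" using c rt_sq[of a] by simp
    show ?thesis using W.ev_in_frac_field[of "smult c P"] W.pow_aut_ev[of h "smult c P"]
        W.sqrt_pow_eq_Jacobi[OF a0 primes c2, of h] unfolding c[symmetric] by auto
  qed
  have gens: "x \<in> W.frac_field \<and> W.pow_aut h x \<in> K"
    if h: "coprime h N" "h \<noteq> 0" and x: "x \<in> gens" for h x
  proof -
    consider "x \<in> \<rat>" | a where "a \<in> S" "x = rt a" | "x = \<zeta>" using x by (auto simp: gens_def)
    thus ?thesis
    proof cases
      case 1
      thus ?thesis using W.pow_aut_rat[OF h(1) 1] by simp
    next
      case 2
      thus ?thesis using root[OF 2(1), of h] h by simp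
    next
      case 3
      thus ?thesis using zeta h by simp
    qed
  qed
  have K_aut: "x \<in> W.frac_field" "W.pow_aut h x \<in> K" if "coprime h N" "h \<noteq> 0" "x \<in> K" for h x
    using W.generate_field_pow_aut[OF that(1) gens[OF that(1,2), unfolded K_def]] that(3) unfolding K_def by auto
  \<comment> \<open>The inverse exponent yields the inverse map on \<open>K\<close>, hence
    bijectivity.\<close>
  obtain h where h: "[g * h = 1] (mod N)" using cong_solve_coprime_nat[OF g(2)] by auto
  hence hg: "[h * g = 1] (mod N)" by (simp add: mult.commute)
  have hN: "coprime h N" using h by (rule coprime_if_cong_mult_1)
  have h0: "h \<noteq> 0" using hN N by (cases "h = 0") auto
  define \<sigma> where "\<sigma> = restrict (W.pow_aut g) K"
  have "bij_betw (W.pow_aut g) K K"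
    by (rule bij_betw_byWitness[where f' = "W.pow_aut h"])
       (simp_all add: K_aut[OF g(2,1)] K_aut[OF hN h0] W.pow_aut_inverse_left[OF g(2) h]
          W.pow_aut_inverse_left[OF hN hg] image_subset_iff)
  moreover have "bij_betw \<sigma> K K \<longleftrightarrow> bij_betw (W.pow_aut g) K K"
    unfolding \<sigma>_def by (rule bij_betw_cong) simp
  ultimately have "bij_betw \<sigma> K K" by simp
  hence "\<sigma> \<in> Bij K" by (simp add: Bij_def \<sigma>_def)
  hence "\<sigma> \<in> carrier Gal" unfolding galois_iff
    by (simp add: \<sigma>_def K_aut(1)[OF g(2,1)] W.pow_aut_add(2)[OF g(2)] W.pow_aut_mult(2)[OF g(2)]
        W.pow_aut_rat(2)[OF g(2)])
  moreover have "acts \<sigma> p"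
    unfolding acts_def
  proof (intro conjI ballI)
    show "\<sigma> \<zeta> = \<zeta> ^ nat (fst p)"
      using zeta(2)[OF g(2)] zeta.power_cong[OF g(3)] by (simp add: \<sigma>_def f\<theta> n)
    show "\<sigma> (rt a) = of_int (snd p a) * rt a" if "a \<in> S" for a
      using root[OF that, of g] g(1,2) g(4)[OF that] that by (simp add: \<sigma>_def f\<theta>)
  qed (use p[unfolded carrier_pairs] in blast)+
  ultimately show ?thesis by blast
qed

section \<open>The isomorphism\<close>

definition \<Psi> :: "(complex \<Rightarrow> complex) \<Rightarrow> int \<times> (int \<Rightarrow> int)" where
  "\<Psi> \<sigma> = (THE p. acts \<sigma> p)"

lemma acts_iff:
  assumes \<sigma>: "\<sigma> \<in> carrier Gal"
  shows "acts \<sigma> p \<longleftrightarrow> \<Psi> \<sigma> = p"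
proof
  show "acts \<sigma> p \<Longrightarrow> \<Psi> \<sigma> = p" unfolding \<Psi>_def using acts_unique by (intro the_equality)
  obtain q where q: "acts \<sigma> q" using acts_exists[OF \<sigma>] by blast
  have "acts \<sigma> (\<Psi> \<sigma>)" unfolding \<Psi>_def using q acts_unique by (intro theI[of "acts \<sigma>"])
  thus "\<Psi> \<sigma> = p \<Longrightarrow> acts \<sigma> p" by simp
qed

text \<open>The target is the full direct product, because \<open>D0_group S d\<close> is not yet
  known to be a group.\<close>

lemma \<Psi>_hom: "group_hom Gal (unit_group_mod d \<times>\<times> sign_maps S) \<Psi>"
proof -
  have "\<Psi> \<in> hom Gal (unit_group_mod d \<times>\<times> sign_maps S)"
  proof (rule homI)
    fix \<sigma> assume "\<sigma> \<in> carrier Gal"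
    thus "\<Psi> \<sigma> \<in> carrier (unit_group_mod d \<times>\<times> sign_maps S)" using acts_iff acts_carrier by metis
  next
    fix \<sigma> \<tau> assume "\<sigma> \<in> carrier Gal" "\<tau> \<in> carrier Gal"
    thus "\<Psi> (\<sigma> \<otimes>\<^bsub>Gal\<^esub> \<tau>) = \<Psi> \<sigma> \<otimes>\<^bsub>unit_group_mod d \<times>\<times> sign_maps S\<^esub> \<Psi> \<tau>"
      using acts_mult acts_iff group_galois by (metis group.is_monoid monoid.m_closed)
  qed
  thus ?thesis using d by (intro group_hom.intro group_hom_axioms.intro group_galois DirProd_group
        group_unit_group_mod group_sign_maps) auto
qed

lemma \<Psi>_image: "\<Psi> ` carrier Gal = carrier (D0_group S d)"
proof (intro equalityI subsetI)
  fix p assume "p \<in> \<Psi> ` carrier Gal"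
  then obtain \<sigma> where \<sigma>: "\<sigma> \<in> carrier Gal" "p = \<Psi> \<sigma>" by blast
  show "p \<in> carrier (D0_group S d)" using acts_imp_D0[OF \<sigma>(1)] acts_iff[OF \<sigma>(1)] \<sigma>(2) by blast
next
  fix p assume "p \<in> carrier (D0_group S d)"
  then obtain \<sigma> where \<sigma>: "\<sigma> \<in> carrier Gal" "acts \<sigma> p" using D0_imp_acts by blast
  hence "p = \<Psi> \<sigma>" using acts_iff by simp
  thus "p \<in> \<Psi> ` carrier Gal" using \<sigma>(1) by (rule image_eqI)
qed

text \<open>The carrier is the image of a homomorphism, hence a subgroup; closure of the Jacobi
  conditions under multiplication comes from the Galois side.\<close>

lemma group_D0: "group (D0_group S d)"
proof -
  interpret group_hom Gal "unit_group_mod d \<times>\<times> sign_maps S" \<Psi> by (rule \<Psi>_hom)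
  show ?thesis using H.subgroup_imp_group[OF img_is_subgroup] unfolding \<Psi>_image D0_group_alt[symmetric] .
qed

lemma \<Psi>_iso: "\<Psi> \<in> iso Gal (D0_group S d)"
proof -
  have "inj_on \<Psi> (carrier Gal)"
  proof (rule inj_onI)
    fix \<sigma> \<tau> assume \<sigma>: "\<sigma> \<in> carrier Gal" "\<tau> \<in> carrier Gal" "\<Psi> \<sigma> = \<Psi> \<tau>"
    hence "acts \<sigma> (\<Psi> \<tau>)" "acts \<tau> (\<Psi> \<tau>)" using acts_iff by metis+
    thus "\<sigma> = \<tau>" using \<sigma> by (intro galois_eqI) (auto simp: acts_def)
  qed
  moreover have "\<Psi> \<in> hom Gal (D0_group S d)"
    using group_hom.homh[OF \<Psi>_hom] \<Psi>_image by (subst D0_group_alt) (auto simp: hom_def)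
  ultimately show ?thesis using \<Psi>_image by (auto simp: iso_def bij_betw_def)
qed

end

theorem theorem4:
  fixes S :: "int set" and d :: nat and \<zeta> :: complex
  assumes "finite S" and "0 \<notin> S"
    and "d \<ge> 3" and "8 dvd d"
    and "primitive_root_of_unity d \<zeta>"
  shows "\<exists>\<Phi>. group_hom (D0_group S d) (galois_group (sqrt_cyclotomic_field S \<zeta>) \<rat>) \<Phi> \<and>
      \<Phi> \<in> iso (D0_group S d) (galois_group (sqrt_cyclotomic_field S \<zeta>) \<rat>) \<and>
      (\<forall>(f, \<theta>)\<in>carrier (D0_group S d).
         \<Phi> (f, \<theta>) \<zeta> = \<zeta> powi f \<and>
         (\<forall>a\<in>S. \<Phi> (f, \<theta>) (csqrt (of_int a)) = of_int (\<theta> a) * csqrt (of_int a)))"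
proof -
  interpret sqrt_cyclotomic S d \<zeta> using assms by unfold_locales
  \<comment> \<open>\<open>\<Psi>\<close> reads a pair off an automorphism. Its inverse is explicit
    because the pair prescribes the values on the generators of \<open>K\<close>.\<close>
  define \<Phi> where "\<Phi> = inv_into (carrier Gal) \<Psi>"
  have iso: "\<Phi> \<in> iso (D0_group S d) Gal"
    unfolding \<Phi>_def by (rule group.iso_set_sym[OF group_galois \<Psi>_iso])
  hence "group_hom (D0_group S d) Gal \<Phi>"
    by (intro group_hom.intro group_hom_axioms.intro group_galois group_D0) (simp add: iso_def)
  moreover have "\<Phi> p \<zeta> = \<zeta> powi fst p \<and> (\<forall>a\<in>S. \<Phi> p (rt a) = of_int (snd p a) * rt a)"
    if p: "p \<in> carrier (D0_group S d)" for p
  proof -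
    have "\<Phi> p \<in> carrier Gal" "\<Psi> (\<Phi> p) = p"
      using p unfolding \<Phi>_def \<Psi>_image[symmetric] by (rule inv_into_into, rule f_inv_into_f)
    hence "acts (\<Phi> p) p" using acts_iff by blast
    \<comment> \<open>Since \<open>fst p\<close> is at least 1, \<open>powi\<close> is the ordinary
      power with exponent \<open>nat (fst p)\<close>.\<close>
    thus ?thesis by (auto simp: acts_def power_int_def)
  qed
  ultimately show ?thesis using iso unfolding rt_def by (intro exI[of _ \<Phi>]) auto
qed

end
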